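(* Let $\Omega\subset\mathbb{R}^2$ be a bounded open set such that $\tau_1(\Omega)$ possesses a positive eigenfunction. Then $$\tau_1(\Omega)\le\tau_1(\Omega^* ).$$ Equality holds only if $\Omega\cong\Omega^*$ up to a translation (that is, some translate of $\Omega^*$ is almost equal to $\Omega$).
   Context: For a bounded open set $\Omega\subset\mathbb{R}^2$, the Logarithmic potential operator $\mathcal{L}$ on $L^2(\Omega)$ (real-valued functions) is $\mathcal{L}u(x)=\frac{1}{2\pi}\int_\Omega \log\frac{1}{|x-y|}\,u(y)\,dy$; it is self-adjoint and compact. Its largest eigenvalue is denoted $\tau_1(\Omega)$ and satisfies $\tau_1(\Omega)=\sup\{E(u):u\in L^2(\Omega),\ \|u\|_{L^2(\Omega)}=1\}$, where $E(u)=\frac{1}{2\pi}\int_\Omega\int_\Omega\log\frac{1}{|x-y|}u(x)u(y)\,dx\,dy$. $\Omega^*$ is the open ball centred at the origin with the same Lebesgue measure as $\Omega$. A positive eigenfunction is an eigenfunction that is positive on all of $\Omega$. For measurable sets $A,B$, $A\cong B$ ("almost equal") means $|A\triangle B|=0$, where $\triangle$ is the symmetric difference and $|\cdot|$ is Lebesgue measure. *)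

theory Defs
  imports "HOL-Analysis.Analysis"
begin

text \<open>Elements of \<open>L\<^sup>2(\<Omega>)\<close> are represented by functions on the whole plane, of which only the
  values on \<open>\<Omega>\<close> matter; equality in \<open>L\<^sup>2(\<Omega>)\<close> is equality almost everywhere on \<open>\<Omega>\<close>.\<close>

definition square_integrable_on :: "(real^2 \<Rightarrow> real) \<Rightarrow> (real^2) set \<Rightarrow> bool" where
  "square_integrable_on u \<Omega> \<longleftrightarrow>
     u \<in> borel_measurable (lebesgue_on \<Omega>) \<and> integrable (lebesgue_on \<Omega>) (\<lambda>x. (u x)\<^sup>2)"

text \<open>On the diagonal the kernel has the value \<open>ln (1 / 0) = 0\<close>; this is a single point \<open>y\<close> for
  each \<open>x\<close> and does not affect the integral.\<close>

definition log_potential :: "(real^2) set \<Rightarrow> (real^2 \<Rightarrow> real) \<Rightarrow> real^2 \<Rightarrow> real" where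
  "log_potential \<Omega> u x =
     1 / (2 * pi) * (LINT y|lebesgue_on \<Omega>. ln (1 / norm (x - y)) * u y)"

definition log_eigenfunction :: "(real^2) set \<Rightarrow> real \<Rightarrow> (real^2 \<Rightarrow> real) \<Rightarrow> bool" where
  "log_eigenfunction \<Omega> \<tau> u \<longleftrightarrow>
     square_integrable_on u \<Omega> \<and>
     \<not> (AE x in lebesgue_on \<Omega>. u x = 0) \<and>
     (AE x in lebesgue_on \<Omega>. log_potential \<Omega> u x = \<tau> * u x)"

definition log_eigenvalue :: "(real^2) set \<Rightarrow> real \<Rightarrow> bool" where
  "log_eigenvalue \<Omega> \<tau> \<longleftrightarrow> (\<exists>u. log_eigenfunction \<Omega> \<tau> u)"

text \<open>Meaningful for nonempty bounded open \<open>\<Omega>\<close>, where the operator is compact and self-adjoint and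
  its quadratic form takes positive values (test it on a function supported in a ball of diameter
  less than 1), so that a largest eigenvalue exists.\<close>

definition tau1 :: "(real^2) set \<Rightarrow> real" where
  "tau1 \<Omega> = (GREATEST \<tau>. log_eigenvalue \<Omega> \<tau>)"

definition positive_log_eigenfunction :: "(real^2) set \<Rightarrow> real \<Rightarrow> (real^2 \<Rightarrow> real) \<Rightarrow> bool" where
  "positive_log_eigenfunction \<Omega> \<tau> u \<longleftrightarrow> log_eigenfunction \<Omega> \<tau> u \<and> (\<forall>x\<in>\<Omega>. 0 < u x)"

definition star_ball :: "(real^2) set \<Rightarrow> (real^2) set" where
  "star_ball \<Omega> =
     ball 0 (THE r. 0 \<le> r \<and> emeasure lebesgue (ball (0::real^2) r) = emeasure lebesgue \<Omega>)"

definition almost_equal :: "(real^2) set \<Rightarrow> (real^2) set \<Rightarrow> bool" where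
  "almost_equal A B \<longleftrightarrow> sym_diff A B \<in> null_sets lebesgue"

end

theory Submission
  imports Defs "HOL-Complex_Analysis.Great_Picard"
begin

text \<open>Write \<open>E(u)\<close> for the double integral of \<open>log (1 / \<bar>x - y\<bar>) u(x) u(y)\<close> (\<open>energy u u\<close> below). A
positive eigenfunction \<open>u\<close> for \<open>\<tau>\<^sub>1(\<Omega>)\<close> satisfies \<open>E(u) = 2\<pi> \<tau>\<^sub>1(\<Omega>) \<parallel>u\<parallel>\<^sup>2\<close>, and on the disc
\<open>E(w) \<le> 2\<pi> \<tau>\<^sub>1(\<Omega>\<^sup>*) \<parallel>w\<parallel>\<^sup>2\<close> for every square integrable \<open>w\<close> (\<open>tau1_variational\<close>). It is therefore
enough to show \<open>E(v) \<le> 2\<pi> \<tau>\<^sub>1(\<Omega>\<^sup>*) \<parallel>v\<parallel>\<^sup>2\<close> for nonnegative \<open>v\<close> whose support has area at most that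
of \<open>\<Omega>\<close>, and to find out when equality holds. This is a form of the Riesz rearrangement inequality
with its equality case; the proof reduces it to reflections.

Polarization in a line replaces the two values of \<open>v\<close> at mirror points so that the larger one lies on
a chosen side. It does not change the distribution of \<open>v\<close>, and since the kernel is a strictly
decreasing function of the distance, it does not decrease the energy; the energy stays the same only
if \<open>v\<close> is one-sided for that line, that is, on one of its two sides \<open>v\<close> dominates its mirror image
almost everywhere (\<open>energy_le_energy_polarize\<close>, \<open>energy_polarize_equality\<close>). Only the monotonicity
of the kernel enters here, so its negative values at large distances do no harm.

The inequality. Among the nonnegative \<open>L\<close>-Lipschitz functions that vanish off a fixed large disc
around the origin, have a given \<open>L\<^sup>2\<close> norm and a support of area at most \<open>\<bar>\<Omega>\<bar>\<close>, one function has
maximal energy, by the Arzela--Ascoli theorem. Polarization towards the origin stays in this class, so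
the maximizer is one-sided for every line. A bounded open set that is one-sided for every line is a
disc up to a null set: the side of the line that dominates must contain the centroid, so the set
contains, up to null sets, every point that is closer to the centroid than one of its points
(\<open>one_sided_open_is_ball\<close>). Hence the maximizer can be translated into \<open>\<Omega>\<^sup>*\<close>, where the bound is
known (\<open>energy_le_lipschitz\<close>). Lower semicontinuous functions are increasing limits of Lipschitz
functions with smaller support, which extends the bound to them (\<open>energy_le_lsc\<close>). An eigenfunction
for \<open>\<tau> > 0\<close> agrees almost everywhere with its own potential divided by \<open>\<tau>\<close>, which is continuous, so
it has a lower semicontinuous representative (\<open>lsc_representative\<close>).

The case of equality. If equality holds for the representative \<open>v\<close>, then the bound, applied to a
polarization of \<open>v\<close>, which is again lower semicontinuous, shows that no polarization increases the
energy. Thus \<open>v\<close> is one-sided for every line, and its support, which is \<open>\<Omega>\<close> up to a null set, is a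
disc (\<open>energy_eq_imp_one_sided\<close>).\<close>

section \<open>The logarithmic kernel\<close>

lemma quadratic_nonneg_discriminant:
  fixes A B C :: real
  assumes "\<And>t. 0 \<le> A + 2 * B * t + C * t\<^sup>2"
  shows "B\<^sup>2 \<le> A * C"
proof (cases "C = 0")
  case True
  have "B = 0"
  proof (rule ccontr)
    assume "B \<noteq> 0"
    then show False
      using assms[of "- (A + 1) / (2 * B)"] True by (simp add: field_simps)
  qed
  then show ?thesis using True by simp
next
  case False
  have "0 \<le> C"
  proof (rule ccontr)
    assume "\<not> 0 \<le> C"
    \<comment> \<open>A point so far out that the quadratic term outweighs the other two.\<close>
    define t where "t = 1 + \<bar>A\<bar> / (- C) + 2 * \<bar>B\<bar> / (- C)"
    have C: "C < 0" using \<open>\<not> 0 \<le> C\<close> by simp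
    have "0 \<le> \<bar>A\<bar> / (- C)" "0 \<le> 2 * \<bar>B\<bar> / (- C)"
      using C by (intro divide_nonneg_nonneg; simp)+
    then have t1: "1 \<le> t" unfolding t_def by linarith
    have Ct: "C * t = C - \<bar>A\<bar> - 2 * \<bar>B\<bar>"
      unfolding t_def using C by (simp add: field_simps)
    have "2 * B * t \<le> 2 * \<bar>B\<bar> * t" using t1 by (intro mult_right_mono) auto
    moreover have "A \<le> \<bar>A\<bar> * t"
      using t1 by (smt (verit) mult_left_mono mult_cancel_left1 abs_ge_self abs_ge_zero mult.right_neutral)
    moreover have "C * t\<^sup>2 = (C - \<bar>A\<bar> - 2 * \<bar>B\<bar>) * t"
      using Ct by (simp add: power2_eq_square mult.assoc[symmetric])
    ultimately have "A + 2 * B * t + C * t\<^sup>2 \<le> C * t" by (simp add: algebra_simps)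
    also have "\<dots> < 0" using C t1 by (simp add: mult_neg_pos)
    finally show False using assms[of t] by simp
  qed
  then have "0 < C" using False by simp
  then show ?thesis
    using assms[of "- B / C"] by (simp add: field_simps power2_eq_square)
qed

definition logk :: "real^2 \<Rightarrow> real^2 \<Rightarrow> real" where
  "logk x y = ln (1 / norm (x - y))"

lemma logk_eq: "logk x y = - ln (norm (x - y))"
  by (simp add: logk_def ln_div)

lemma logk_commute: "logk x y = logk y x"
  by (simp add: logk_def norm_minus_commute)

lemma measurable_logk [measurable]:
  assumes [measurable]: "f \<in> borel_measurable M" "g \<in> borel_measurable M"
  shows "(\<lambda>z. logk (f z) (g z)) \<in> borel_measurable M"
  unfolding logk_def by measurable

declare borel_closed[OF closed_cball, measurable] borel_open[OF open_ball, measurable]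

text \<open>The dyadic discs around \<open>x\<close> turn integrals of \<open>1 / \<bar>x - y\<bar>\<close> into a geometric series of areas.\<close>

lemma inverse_norm_le_dyadic_sum:
  fixes x y :: "'a::real_normed_vector"
  shows "ennreal (1 / norm (x - y))
    \<le> 1 + (\<Sum>n. ennreal (2 ^ (n + 1)) * indicator (ball x ((1/2) ^ n)) y)"
proof -
  define r where "r = norm (x - y)"
  consider "r = 0" | "1 \<le> r" | "0 < r" "r < 1"
    unfolding r_def by fastforce
  then show ?thesis
  proof cases
    case 1
    then show ?thesis by (simp add: r_def)
  next
    case 2
    then have "ennreal (1 / r) \<le> ennreal 1" by (intro ennreal_leI) simp
    then show ?thesis unfolding r_def by (simp add: add_increasing2)
  next
    case 3
    define m where "m = (LEAST n. (1/2::real) ^ n \<le> r)"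
    have ex: "\<exists>n. (1/2::real) ^ n \<le> r"
      using real_arch_pow_inv[of r "1/2"] 3 by (auto intro: less_imp_le)
    have m: "(1/2) ^ m \<le> r" unfolding m_def by (rule LeastI_ex[OF ex])
    have "m \<noteq> 0" using m 3 by (cases m) auto
    then obtain n where n: "m = Suc n" using not0_implies_Suc by blast
    have "\<not> (1/2) ^ n \<le> r"
      unfolding m_def using n m_def by (metis lessI not_less_Least)
    then have ind: "y \<in> ball x ((1/2) ^ n)" by (simp add: r_def dist_norm)
    have "1 / r \<le> 2 ^ (n + 1)"
      using m n 3 by (simp add: field_simps power_one_over)
    then have "ennreal (1 / r) \<le> ennreal (2 ^ (n + 1)) * indicator (ball x ((1/2) ^ n)) y"
      using ind by (simp add: ennreal_leI)
    also have "\<dots> \<le> (\<Sum>n. ennreal (2 ^ (n + 1)) * indicator (ball x ((1/2) ^ n)) y)"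
    proof -
      have "f n \<le> (\<Sum>n. f n)" for f :: "nat \<Rightarrow> ennreal"
        using sum_le_suminf[of f "{n}"] by simp
      then show ?thesis .
    qed
    also have "\<dots> \<le> 1 + \<dots>" by simp
    finally show ?thesis by (simp add: r_def)
  qed
qed

lemma emeasure_lborel_ball_plane:
  "0 \<le> r \<Longrightarrow> emeasure lborel (ball (x::real^2) r) = ennreal (pi * r\<^sup>2)"
  by (simp add: emeasure_ball eval_unit_ball_vol)

lemma integrable_indicator_cball:
  "integrable lborel (indicator (cball (0::real^2) R) :: _ \<Rightarrow> real)"
  using emeasure_lborel_cball_finite[of "0::real^2" R]
  by (intro integrable_real_indicator) auto

lemma bounded_subset_cball_0:
  fixes S :: "'a::real_normed_vector set"
  assumes "bounded S"
  obtains R where "0 \<le> R" "S \<subseteq> cball 0 R"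
proof -
  obtain b where "0 < b" "\<forall>x\<in>S. norm x \<le> b" using assms unfolding bounded_pos by blast
  then show thesis by (intro that[of b]) auto
qed

lemma measure_open_bounded_pos:
  fixes U :: "'a::euclidean_space set"
  assumes "open U" "bounded U" "U \<noteq> {}"
  shows "0 < measure lborel U"
proof -
  obtain p e where pe: "p \<in> U" "0 < e" "ball p e \<subseteq> U"
    using assms(1,3) open_contains_ball by (metis ex_in_conv)
  have "measure lborel (ball p e) \<le> measure lborel U"
    using pe(3) assms(1) emeasure_bounded_finite[OF assms(2)]
    by (intro measure_mono_fmeasurable) (auto simp: fmeasurable_def)
  then show ?thesis using content_ball_pos[OF pe(2), of p] by linarith
qed

lemma nn_integral_inverse_norm_cball:
  fixes x :: "real^2"
  assumes "0 \<le> R"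
  shows "(\<integral>\<^sup>+y. ennreal (1 / norm (x - y)) * indicator (cball 0 R) y \<partial>lborel)
    \<le> ennreal (pi * R\<^sup>2 + 4 * pi)"
proof -
  let ?S = "\<lambda>y. \<Sum>n. ennreal (2 ^ (n + 1)) * indicator (ball x ((1/2) ^ n)) y"
  have "(\<integral>\<^sup>+y. ennreal (1 / norm (x - y)) * indicator (cball 0 R) y \<partial>lborel)
      \<le> (\<integral>\<^sup>+y. indicator (cball 0 R) y + ?S y \<partial>lborel)"
    using inverse_norm_le_dyadic_sum[of x]
    by (intro nn_integral_mono) (auto split: split_indicator)
  also have "\<dots> = emeasure lborel (cball (0::real^2) R) + (\<integral>\<^sup>+y. ?S y \<partial>lborel)"
    by (subst nn_integral_add) auto
  also have "(\<integral>\<^sup>+y. ?S y \<partial>lborel)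
      = (\<Sum>n. \<integral>\<^sup>+y. ennreal (2 ^ (n + 1)) * indicator (ball x ((1/2) ^ n)) y \<partial>lborel)"
    by (rule nn_integral_suminf) auto
  also have "\<dots> = (\<Sum>n. ennreal (2 * pi * (1/2) ^ n))"
  proof (intro suminf_cong)
    fix n :: nat
    have "(2::real) ^ (n + 1) * (pi * ((1/2) ^ n)\<^sup>2) = 2 * pi * (1/2) ^ n"
      by (simp add: power_one_over power2_eq_square field_simps)
    then show "(\<integral>\<^sup>+y. ennreal (2 ^ (n + 1)) * indicator (ball x ((1/2) ^ n)) y \<partial>lborel)
        = ennreal (2 * pi * (1/2) ^ n)"
      by (subst nn_integral_cmult_indicator)
        (auto simp: emeasure_lborel_ball_plane ennreal_mult[symmetric])
  qed
  also have "\<dots> = ennreal (\<Sum>n. 2 * pi * (1/2) ^ n)"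
    by (rule suminf_ennreal2) (auto intro!: summable_mult summable_geometric)
  also have "(\<Sum>n. 2 * pi * (1/2::real) ^ n) = 4 * pi"
    by (subst suminf_mult) (auto simp: suminf_geometric summable_geometric)
  also have "emeasure lborel (cball (0::real^2) R) = ennreal (pi * R\<^sup>2)"
    using assms by (simp add: emeasure_cball eval_unit_ball_vol)
  also have "ennreal (pi * R\<^sup>2) + ennreal (4 * pi) = ennreal (pi * R\<^sup>2 + 4 * pi)"
    by (simp add: ennreal_plus)
  finally show ?thesis .
qed

lemma
  fixes x :: "real^2"
  assumes "0 \<le> R"
  shows integrable_inverse_norm_cball:
      "integrable lborel (\<lambda>y. indicator (cball 0 R) y * (1 / norm (x - y)))"
    and integral_inverse_norm_cball:
      "(LINT y|lborel. indicator (cball 0 R) y * (1 / norm (x - y))) \<le> pi * R\<^sup>2 + 4 * pi"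
proof -
  let ?f = "\<lambda>y. indicator (cball 0 R) y * (1 / norm (x - y))"
  have eq: "(\<integral>\<^sup>+y. ennreal (?f y) \<partial>lborel)
      = (\<integral>\<^sup>+y. ennreal (1 / norm (x - y)) * indicator (cball 0 R) y \<partial>lborel)"
    by (intro nn_integral_cong) (auto split: split_indicator)
  have le: "(\<integral>\<^sup>+y. ennreal (?f y) \<partial>lborel) \<le> ennreal (pi * R\<^sup>2 + 4 * pi)"
    unfolding eq by (rule nn_integral_inverse_norm_cball[OF assms])
  show int: "integrable lborel ?f"
  proof (rule integrableI_nonneg)
    show "(\<integral>\<^sup>+y. ennreal (?f y) \<partial>lborel) < \<infinity>"
      using le by (rule order.strict_trans1) simp
    show "?f \<in> borel_measurable lborel" by measurable
  qed auto
  have "ennreal (integral\<^sup>L lborel ?f) \<le> ennreal (pi * R\<^sup>2 + 4 * pi)"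
    using le by (subst nn_integral_eq_integral[OF int, symmetric]) auto
  moreover have "0 \<le> pi * R\<^sup>2 + 4 * pi" by simp
  ultimately show "integral\<^sup>L lborel ?f \<le> pi * R\<^sup>2 + 4 * pi"
    by (simp only: ennreal_le_iff)
qed

text \<open>Together with \<open>ln_diff_square_le\<close> this reduces every estimate of the kernel in \<open>L\<^sup>2\<close> to the
integrability of \<open>1 / \<bar>x - y\<bar>\<close>. Both follow from \<open>ln s \<le> s\<close> and \<open>ln s \<le> s - 1\<close> applied to a square
root, which costs only half a power of the distance.\<close>

lemma ln_square_le:
  fixes r :: real
  assumes "0 < r"
  shows "(ln r)\<^sup>2 \<le> 4 / r + r\<^sup>2"
proof (cases "1 \<le> r")
  case True
  then have "(ln r)\<^sup>2 \<le> r\<^sup>2"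
    using ln_bound[of r] by (intro power_mono) auto
  then show ?thesis using assms by (simp add: add_increasing)
next
  case False
  have "ln (1 / sqrt r) \<le> 1 / sqrt r"
    using assms by (intro ln_bound) auto
  moreover have "ln (1 / sqrt r) = - ln r / 2"
    using assms by (simp add: ln_div ln_sqrt)
  ultimately have "- ln r \<le> 2 / sqrt r" by simp
  moreover have "0 \<le> - ln r" using False assms by simp
  ultimately have "(- ln r)\<^sup>2 \<le> (2 / sqrt r)\<^sup>2" by (intro power_mono)
  then show ?thesis using assms
    by (simp add: power_divide add_increasing2)
qed

text \<open>For \<open>b \<le> a\<close> one has \<open>ln a - ln b \<le> 2 (sqrt (a / b) - 1)\<close>, and the square of the right-hand side is at
most \<open>4 (a - b) / b\<close>. The factor \<open>\<bar>a - b\<bar>\<close> is what makes potentials Hoelder continuous.\<close>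

lemma ln_diff_square_le:
  fixes a b :: real
  assumes "0 < a" "0 < b"
  shows "(ln a - ln b)\<^sup>2 \<le> 4 * \<bar>a - b\<bar> * (1 / a + 1 / b)"
proof -
  have *: "(ln a - ln b)\<^sup>2 \<le> 4 * (a - b) * (1 / b)" if "b \<le> a" "0 < b" for a b :: real
  proof -
    have "0 < a" using that by simp
    have "ln (sqrt (a / b)) \<le> sqrt (a / b) - 1"
      using that by (intro ln_le_minus_one) auto
    moreover have "ln (sqrt (a / b)) = (ln a - ln b) / 2"
      using that by (simp add: ln_div ln_sqrt)
    ultimately have "ln a - ln b \<le> 2 * (sqrt (a / b) - 1)" by simp
    moreover have "0 \<le> ln a - ln b" using that by simp
    ultimately have "(ln a - ln b)\<^sup>2 \<le> (2 * (sqrt (a / b) - 1))\<^sup>2" by (intro power_mono)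
    also have "\<dots> = 4 * (a / b - 2 * sqrt (a / b) + 1)"
    proof -
      have "(sqrt (a / b))\<^sup>2 = a / b" using that by simp
      then show ?thesis by (simp add: power2_eq_square algebra_simps)
    qed
    also have "\<dots> \<le> 4 * (a / b - 1)"
      using that by simp
    also have "\<dots> = 4 * (a - b) * (1 / b)" using that by (simp add: field_simps)
    finally show ?thesis .
  qed
  show ?thesis
  proof (cases "b \<le> a")
    case True
    have "(ln a - ln b)\<^sup>2 \<le> 4 * (a - b) * (1 / b)" using * True assms by simp
    also have "\<dots> \<le> 4 * \<bar>a - b\<bar> * (1 / a + 1 / b)"
      using True assms by (intro mult_mono) auto
    finally show ?thesis .
  next
    case False
    have "(ln a - ln b)\<^sup>2 = (ln b - ln a)\<^sup>2" by (rule power2_commute)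
    also have "\<dots> \<le> 4 * (b - a) * (1 / a)" using * False assms by simp
    also have "\<dots> \<le> 4 * \<bar>a - b\<bar> * (1 / a + 1 / b)"
      using False assms by (intro mult_mono) auto
    finally show ?thesis .
  qed
qed

text \<open>Borel representatives that vanish off \<open>S\<close> make all integrals integrals over the plane, so that
functions with different supports, such as a function and its mirror image, can be compared.\<close>

definition L2on :: "(real^2) set \<Rightarrow> (real^2 \<Rightarrow> real) set" where
  "L2on S = {u. u \<in> borel_measurable borel \<and> integrable lborel (\<lambda>x. (u x)\<^sup>2) \<and> (\<forall>x. x \<notin> S \<longrightarrow> u x = 0)}"

lemma L2onD:
  assumes "u \<in> L2on S"
  shows "u \<in> borel_measurable borel" "integrable lborel (\<lambda>x. (u x)\<^sup>2)" "x \<notin> S \<Longrightarrow> u x = 0"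
  using assms by (auto simp: L2on_def)

lemma L2on_mono: "S \<subseteq> S' \<Longrightarrow> u \<in> L2on S \<Longrightarrow> u \<in> L2on S'"
  by (auto simp: L2on_def)

lemma integrable_mult_squares:
  fixes u v :: "'a \<Rightarrow> real"
  assumes [measurable]: "u \<in> borel_measurable M" "v \<in> borel_measurable M"
    and "integrable M (\<lambda>x. (u x)\<^sup>2)" "integrable M (\<lambda>x. (v x)\<^sup>2)"
  shows "integrable M (\<lambda>x. u x * v x)"
proof (rule Bochner_Integration.integrable_bound)
  show "integrable M (\<lambda>x. (u x)\<^sup>2 + (v x)\<^sup>2)" using assms by auto
  have "\<bar>u x * v x\<bar> \<le> (u x)\<^sup>2 + (v x)\<^sup>2" for x
  proof -
    have "0 \<le> \<bar>u x\<bar> * \<bar>v x\<bar>" by simp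
    moreover have "2 * (\<bar>u x\<bar> * \<bar>v x\<bar>) \<le> (u x)\<^sup>2 + (v x)\<^sup>2"
      using sum_squares_bound[of "\<bar>u x\<bar>" "\<bar>v x\<bar>"] by (simp add: mult.assoc)
    ultimately show ?thesis unfolding abs_mult by linarith
  qed
  then show "AE x in M. norm (u x * v x) \<le> norm ((u x)\<^sup>2 + (v x)\<^sup>2)"
    by (auto intro: order_trans)
qed measurable

lemma L2on_integrable_mult:
  assumes "u \<in> L2on S" "v \<in> L2on S'"
  shows "integrable lborel (\<lambda>x. u x * v x)"
  using assms by (intro integrable_mult_squares) (auto simp: L2on_def)

lemma L2on_scale_add:
  assumes "u \<in> L2on S" "v \<in> L2on S"
  shows "(\<lambda>x. a * u x + b * v x) \<in> L2on S"
proof -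
  note [measurable] = L2onD(1)[OF assms(1)] L2onD(1)[OF assms(2)]
  have "(\<lambda>x. (a * u x + b * v x)\<^sup>2) = (\<lambda>x. a\<^sup>2 * (u x)\<^sup>2 + b\<^sup>2 * (v x)\<^sup>2 + (2 * a * b) * (u x * v x))"
    by (auto simp: power2_eq_square algebra_simps)
  then have "integrable lborel (\<lambda>x. (a * u x + b * v x)\<^sup>2)"
    using L2onD(2)[OF assms(1)] L2onD(2)[OF assms(2)] L2on_integrable_mult[OF assms] by auto
  then show ?thesis
    using assms unfolding L2on_def by auto
qed

text \<open>The quadratic polynomial \<open>t \<mapsto> \<integral> (u + t v)\<^sup>2\<close> is nonnegative.\<close>

lemma Cauchy_Schwarz_integral:
  fixes u v :: "'a \<Rightarrow> real"
  assumes m: "u \<in> borel_measurable M" "v \<in> borel_measurable M"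
    and i: "integrable M (\<lambda>x. (u x)\<^sup>2)" "integrable M (\<lambda>x. (v x)\<^sup>2)"
  shows "(LINT x|M. u x * v x)\<^sup>2 \<le> (LINT x|M. (u x)\<^sup>2) * (LINT x|M. (v x)\<^sup>2)"
proof (rule quadratic_nonneg_discriminant)
  fix t
  note iuv = integrable_mult_squares[OF m i]
  have "0 \<le> (LINT x|M. (u x + t * v x)\<^sup>2)" by (rule integral_nonneg_AE) simp
  also have "(\<lambda>x. (u x + t * v x)\<^sup>2) = (\<lambda>x. (u x)\<^sup>2 + (2 * t) * (u x * v x) + t\<^sup>2 * (v x)\<^sup>2)"
    by (auto simp: power2_eq_square algebra_simps)
  also have "(LINT x|M. (u x)\<^sup>2 + (2 * t) * (u x * v x) + t\<^sup>2 * (v x)\<^sup>2)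
      = (LINT x|M. (u x)\<^sup>2) + 2 * (LINT x|M. u x * v x) * t + (LINT x|M. (v x)\<^sup>2) * t\<^sup>2"
    using i iuv by simp
  finally show "0 \<le> (LINT x|M. (u x)\<^sup>2) + 2 * (LINT x|M. u x * v x) * t + (LINT x|M. (v x)\<^sup>2) * t\<^sup>2" .
qed

lemma logk_square_le: "(logk x y)\<^sup>2 \<le> 4 * (1 / norm (x - y)) + (norm (x - y))\<^sup>2"
  using ln_square_le[of "norm (x - y)"] by (cases "x = y") (auto simp: logk_eq)

text \<open>Cutting the kernel off outside a disc makes it a square integrable function of \<open>y\<close>. The integral
against a function supported in the disc does not notice the cut.\<close>

definition kslice :: "real \<Rightarrow> real^2 \<Rightarrow> real^2 \<Rightarrow> real" where
  "kslice R x y = indicator (cball 0 R) y * logk x y"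

lemma kslice_measurable [measurable]: "kslice R x \<in> borel_measurable borel"
  unfolding kslice_def by measurable

lemma
  assumes "0 \<le> R" "x \<in> cball 0 R"
  shows kslice_square_integrable: "integrable lborel (\<lambda>y. (kslice R x y)\<^sup>2)"
    and kslice_square_integral:
      "(LINT y|lborel. (kslice R x y)\<^sup>2) \<le> 4 * (pi * R\<^sup>2 + 4 * pi) + (2 * R)\<^sup>2 * (pi * R\<^sup>2)"
proof -
  let ?g = "\<lambda>y. 4 * (indicator (cball 0 R) y * (1 / norm (x - y))) + (2 * R)\<^sup>2 * indicator (cball 0 R) y"
  have g: "integrable lborel ?g"
    using integrable_inverse_norm_cball[OF assms(1), of x] integrable_indicator_cball
    by (intro Bochner_Integration.integrable_add integrable_mult_right)
  have le: "(kslice R x y)\<^sup>2 \<le> ?g y" for y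
  proof (cases "y \<in> cball 0 R")
    case True
    have "norm (x - y) \<le> 2 * R"
      using True assms norm_triangle_ineq4[of x y] by auto
    then have "(norm (x - y))\<^sup>2 \<le> (2 * R)\<^sup>2" by (intro power_mono) auto
    then show ?thesis using logk_square_le[of x y] True by (simp add: kslice_def)
  qed (auto simp: kslice_def)
  show int: "integrable lborel (\<lambda>y. (kslice R x y)\<^sup>2)"
  proof (rule Bochner_Integration.integrable_bound[OF g])
    show "AE y in lborel. norm ((kslice R x y)\<^sup>2) \<le> norm (?g y)"
      using le by (auto intro!: order_trans[OF le])
  qed measurable
  have "(LINT y|lborel. (kslice R x y)\<^sup>2) \<le> (LINT y|lborel. ?g y)"
    using int g le by (intro integral_mono) auto
  also have "\<dots> = 4 * (LINT y|lborel. indicator (cball 0 R) y * (1 / norm (x - y)))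
      + (2 * R)\<^sup>2 * measure lborel (cball (0::real^2) R)"
  proof -
    define h where "h = (\<lambda>y. indicator (cball 0 R) y * (1 / norm (x - y)))"
    have "integrable lborel h"
      unfolding h_def by (rule integrable_inverse_norm_cball[OF assms(1)])
    then have "(LINT y|lborel. 4 * h y + (2 * R)\<^sup>2 * indicator (cball 0 R) y)
        = 4 * integral\<^sup>L lborel h + (2 * R)\<^sup>2 * measure lborel (cball (0::real^2) R)"
      using integrable_indicator_cball by (subst Bochner_Integration.integral_add) auto
    then show ?thesis by (simp only: h_def)
  qed
  also have "measure lborel (cball (0::real^2) R) = pi * R\<^sup>2"
    using assms by (simp add: content_cball eval_unit_ball_vol)
  also have "4 * (LINT y|lborel. indicator (cball 0 R) y * (1 / norm (x - y))) \<le> 4 * (pi * R\<^sup>2 + 4 * pi)"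
    using integral_inverse_norm_cball[OF assms(1), of x] by (intro mult_left_mono) auto
  finally show "(LINT y|lborel. (kslice R x y)\<^sup>2)
      \<le> 4 * (pi * R\<^sup>2 + 4 * pi) + (2 * R)\<^sup>2 * (pi * R\<^sup>2)"
    by simp
qed

lemma kslice_L2on: "0 \<le> R \<Longrightarrow> x \<in> cball 0 R \<Longrightarrow> kslice R x \<in> L2on (cball 0 R)"
  using kslice_square_integrable by (auto simp: L2on_def) (auto simp: kslice_def)

lemma kslice_diff_square_integral:
  assumes R: "0 \<le> R" "x \<in> cball 0 R" "x' \<in> cball 0 R"
  shows "(LINT y|lborel. (kslice R x y - kslice R x' y)\<^sup>2)
    \<le> 8 * (pi * R\<^sup>2 + 4 * pi) * norm (x - x')"
proof -
  let ?c = "indicator (cball 0 R) :: real^2 \<Rightarrow> real"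
  let ?g = "\<lambda>y. (4 * norm (x - x')) * (?c y * (1 / norm (x - y)) + ?c y * (1 / norm (x' - y)))"
  have ii: "integrable lborel (\<lambda>y. ?c y * (1 / norm (x - y)))" for x
    by (rule integrable_inverse_norm_cball[OF R(1)])
  have g: "integrable lborel ?g" using ii by auto
  have le: "AE y in lborel. (kslice R x y - kslice R x' y)\<^sup>2 \<le> ?g y"
    using AE_lborel_singleton[of x] AE_lborel_singleton[of x']
  proof eventually_elim
    case (elim y)
    show ?case
    proof (cases "y \<in> cball 0 R")
      case True
      have "\<bar>norm (x - y) - norm (x' - y)\<bar> \<le> norm (x - x')"
        using norm_triangle_ineq3[of "x - y" "x' - y"] by simp
      then have "(ln (norm (x - y)) - ln (norm (x' - y)))\<^sup>2
          \<le> 4 * norm (x - x') * (1 / norm (x - y) + 1 / norm (x' - y))"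
        using ln_diff_square_le[of "norm (x - y)" "norm (x' - y)"] elim
        by (smt (verit) mult_right_mono zero_less_norm_iff right_minus_eq divide_pos_pos)
      then show ?thesis using True by (simp add: kslice_def logk_eq power2_commute)
    qed (auto simp: kslice_def)
  qed
  have "integrable lborel (\<lambda>y. (1 * kslice R x y + (-1) * kslice R x' y)\<^sup>2)"
    using L2on_scale_add[OF kslice_L2on kslice_L2on, of R x x' 1 "-1"] R
    by (intro L2onD) auto
  then have "(LINT y|lborel. (kslice R x y - kslice R x' y)\<^sup>2) \<le> (LINT y|lborel. ?g y)"
    using g le by (intro integral_mono_AE) auto
  also have "\<dots> = 4 * norm (x - x') * ((LINT y|lborel. ?c y * (1 / norm (x - y)))
      + (LINT y|lborel. ?c y * (1 / norm (x' - y))))"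
    using ii by (subst integral_mult_right_zero, subst Bochner_Integration.integral_add) auto
  also have "\<dots> \<le> 4 * norm (x - x') * ((pi * R\<^sup>2 + 4 * pi) + (pi * R\<^sup>2 + 4 * pi))"
    using integral_inverse_norm_cball[OF R(1)]
    by (intro mult_left_mono add_mono) auto
  finally show ?thesis by (simp add: algebra_simps)
qed

section \<open>Potential and energy\<close>

text \<open>\<open>slice_bound R\<close> bounds the square of the \<open>L\<^sup>2\<close> norm of every slice of the kernel over the disc of
radius \<open>R\<close>, and \<open>Hoelder_const R\<close> that of the difference of two slices, per unit distance.\<close>

definition slice_bound :: "real \<Rightarrow> real" where
  "slice_bound R = 4 * (pi * R\<^sup>2 + 4 * pi) + (2 * R)\<^sup>2 * (pi * R\<^sup>2)"

definition Hoelder_const :: "real \<Rightarrow> real" where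
  "Hoelder_const R = 8 * (pi * R\<^sup>2 + 4 * pi)"

lemma slice_bound_nonneg: "0 \<le> slice_bound R" and Hoelder_const_pos: "0 < Hoelder_const R"
  by (simp_all add: slice_bound_def Hoelder_const_def add_nonneg_pos)

text \<open>The factor \<open>1 / (2\<pi>)\<close> of the logarithmic potential is left out; it reappears in the relation between
eigenvalues and energies.\<close>

definition logT :: "(real^2 \<Rightarrow> real) \<Rightarrow> real^2 \<Rightarrow> real" where
  "logT u x = (LINT y|lborel. logk x y * u y)"

definition energy :: "(real^2 \<Rightarrow> real) \<Rightarrow> (real^2 \<Rightarrow> real) \<Rightarrow> real" where
  "energy u v = (LINT z|(lborel \<Otimes>\<^sub>M lborel). logk (fst z) (snd z) * (u (fst z) * v (snd z)))"

lemma logk_mult_L2on: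
  assumes "u \<in> L2on (cball 0 R)"
  shows "logk x y * u y = kslice R x y * u y"
  using L2onD(3)[OF assms, of y] by (cases "y \<in> cball 0 R") (auto simp: kslice_def)

lemma logT_kslice: "u \<in> L2on (cball 0 R) \<Longrightarrow> logT u x = (LINT y|lborel. kslice R x y * u y)"
  unfolding logT_def by (simp only: logk_mult_L2on)

lemma logT_integrable:
  assumes "0 \<le> R" "x \<in> cball 0 R" "u \<in> L2on (cball 0 R)"
  shows "integrable lborel (\<lambda>y. logk x y * u y)"
  unfolding logk_mult_L2on[OF assms(3)]
  using L2on_integrable_mult[OF kslice_L2on[OF assms(1,2)] assms(3)] .

lemma logT_square_le:
  assumes "0 \<le> R" "x \<in> cball 0 R" "u \<in> L2on (cball 0 R)"
  shows "(logT u x)\<^sup>2 \<le> slice_bound R * (LINT y|lborel. (u y)\<^sup>2)"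
proof -
  note k = kslice_L2on[OF assms(1,2)]
  have "(logT u x)\<^sup>2 \<le> (LINT y|lborel. (kslice R x y)\<^sup>2) * (LINT y|lborel. (u y)\<^sup>2)"
    unfolding logT_kslice[OF assms(3)]
    using L2onD(1,2)[OF k] L2onD(1,2)[OF assms(3)]
    by (intro Cauchy_Schwarz_integral) auto
  also have "\<dots> \<le> slice_bound R * (LINT y|lborel. (u y)\<^sup>2)"
    using kslice_square_integral[OF assms(1,2)]
    by (intro mult_right_mono integral_nonneg_AE) (auto simp: slice_bound_def)
  finally show ?thesis .
qed

text \<open>Potentials of a bounded set of \<open>L\<^sup>2\<close> functions are equicontinuous. All compactness used for the
operator comes from this estimate.\<close>

lemma logT_Hoelder:
  assumes "0 \<le> R" "x \<in> cball 0 R" "x' \<in> cball 0 R" "u \<in> L2on (cball 0 R)"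
  shows "(logT u x - logT u x')\<^sup>2 \<le> Hoelder_const R * (LINT y|lborel. (u y)\<^sup>2) * norm (x - x')"
proof -
  have d: "(\<lambda>y. kslice R x y - kslice R x' y) \<in> L2on (cball 0 R)"
    using L2on_scale_add[OF kslice_L2on[OF assms(1,2)] kslice_L2on[OF assms(1,3)], of 1 "-1"]
    by simp
  have "logT u x - logT u x' = (LINT y|lborel. (kslice R x y - kslice R x' y) * u y)"
    unfolding logT_kslice[OF assms(4)] left_diff_distrib
    using L2on_integrable_mult[OF kslice_L2on[OF assms(1,2)] assms(4)]
      L2on_integrable_mult[OF kslice_L2on[OF assms(1,3)] assms(4)]
    by (rule Bochner_Integration.integral_diff[symmetric])
  then have "(logT u x - logT u x')\<^sup>2
      \<le> (LINT y|lborel. (kslice R x y - kslice R x' y)\<^sup>2) * (LINT y|lborel. (u y)\<^sup>2)"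
    using Cauchy_Schwarz_integral[of "\<lambda>y. kslice R x y - kslice R x' y" lborel u]
      L2onD(1,2)[OF d] L2onD(1,2)[OF assms(4)] by auto
  also have "\<dots> \<le> (Hoelder_const R * norm (x - x')) * (LINT y|lborel. (u y)\<^sup>2)"
    using kslice_diff_square_integral[OF assms(1-3)]
    by (intro mult_right_mono integral_nonneg_AE) (auto simp: Hoelder_const_def)
  finally show ?thesis by (simp add: mult_ac)
qed

lemma logT_measurable [measurable]:
  assumes [measurable]: "u \<in> borel_measurable borel"
  shows "logT u \<in> borel_measurable borel"
  unfolding logT_def by measurable

lemma bounded_L2on:
  fixes u :: "real^2 \<Rightarrow> real"
  assumes [measurable]: "u \<in> borel_measurable borel"
    and b: "\<And>x. \<bar>u x\<bar> \<le> B" and z: "\<And>x. x \<notin> S \<Longrightarrow> u x = 0" and S: "S \<subseteq> cball 0 R"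
  shows "u \<in> L2on S"
proof -
  have "integrable lborel (\<lambda>x. (u x)\<^sup>2)"
  proof (rule Bochner_Integration.integrable_bound[OF integrable_mult_right[OF integrable_indicator_cball, of "B\<^sup>2"]])
    have "(u x)\<^sup>2 \<le> B\<^sup>2 * indicator (cball 0 R) x" for x
    proof (cases "x \<in> S")
      case True
      have "\<bar>u x\<bar>\<^sup>2 \<le> B\<^sup>2" using b[of x] by (intro power_mono) auto
      then show ?thesis using S True by (auto simp: indicator_def)
    qed (simp add: z)
    then show "AE x in lborel. norm ((u x)\<^sup>2) \<le> norm (B\<^sup>2 * indicator (cball 0 R) x)" by simp
  qed measurable
  then show ?thesis using z by (auto simp: L2on_def)
qed

lemma indicator_L2on: "A \<in> sets borel \<Longrightarrow> A \<subseteq> cball 0 R \<Longrightarrow> indicator A \<in> L2on A"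
  by (rule bounded_L2on[where B = 1 and R = R]) (auto simp: indicator_def)

lemma L2on_integrable:
  assumes "u \<in> L2on (cball 0 R)"
  shows "integrable lborel u"
proof -
  have "u = (\<lambda>x. u x * indicator (cball 0 R) x)"
    using L2onD(3)[OF assms] by (auto simp: indicator_def fun_eq_iff)
  then show ?thesis
    using L2on_integrable_mult[OF assms indicator_L2on[of "cball 0 R" R]] by simp
qed

lemma L2on_abs: "u \<in> L2on S \<Longrightarrow> (\<lambda>x. \<bar>u x\<bar>) \<in> L2on S"
  by (auto simp: L2on_def)

lemma energy_integrand_measurable:
  assumes [measurable]: "u \<in> borel_measurable borel" "v \<in> borel_measurable borel"
  shows "(\<lambda>z. logk (fst z) (snd z) * (u (fst z) * v (snd z))) \<in> borel_measurable (lborel \<Otimes>\<^sub>M lborel)"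
  by measurable

lemma energy_integrable:
  assumes R: "0 \<le> R" and u: "u \<in> L2on (cball 0 R)" and v: "v \<in> L2on (cball 0 R)"
  shows "integrable (lborel \<Otimes>\<^sub>M lborel) (\<lambda>z. logk (fst z) (snd z) * (u (fst z) * v (snd z)))"
proof (rule lborel_pair.Fubini_integrable)
  note m [measurable] = L2onD(1)[OF u] L2onD(1)[OF v]
  show "(\<lambda>z. logk (fst z) (snd z) * (u (fst z) * v (snd z))) \<in> borel_measurable (lborel \<Otimes>\<^sub>M lborel)"
    by (rule energy_integrand_measurable[OF m])
  define c where "c = sqrt (slice_bound R * (LINT y|lborel. (v y)\<^sup>2))"
  have ku: "integrable lborel (\<lambda>y. logk x y * (u x * v y))" for x
  proof (cases "x \<in> cball 0 R")
    case True
    show ?thesis using integrable_mult_right[OF logT_integrable[OF R True v], of "u x"]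
      by (simp add: mult_ac)
  qed (simp add: L2onD(3)[OF u])
  then show "AE x in lborel. integrable lborel (\<lambda>y. logk (fst (x, y)) (snd (x, y)) * (u (fst (x, y)) * v (snd (x, y))))"
    by simp
  have inner: "\<bar>LINT y|lborel. \<bar>logk x y * (u x * v y)\<bar>\<bar> \<le> c * \<bar>u x\<bar>" for x
  proof (cases "x \<in> cball 0 R")
    case True
    note k = L2on_abs[OF kslice_L2on[OF R True]] and av = L2on_abs[OF v]
    define I where "I = (LINT y|lborel. \<bar>kslice R x y\<bar> * \<bar>v y\<bar>)"
    have "I\<^sup>2 \<le> (LINT y|lborel. \<bar>kslice R x y\<bar>\<^sup>2) * (LINT y|lborel. \<bar>v y\<bar>\<^sup>2)"
      unfolding I_def using L2onD(1,2)[OF k] L2onD(1,2)[OF av]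
      by (intro Cauchy_Schwarz_integral) auto
    also have "\<dots> \<le> slice_bound R * (LINT y|lborel. (v y)\<^sup>2)"
      using kslice_square_integral[OF R True] unfolding power2_abs
      by (intro mult_right_mono integral_nonneg_AE) (auto simp: slice_bound_def)
    finally have I: "I \<le> c" unfolding c_def by (rule real_le_rsqrt)
    have I0: "0 \<le> I" unfolding I_def by (intro integral_nonneg_AE) auto
    have "(LINT y|lborel. \<bar>logk x y * (u x * v y)\<bar>) = (LINT y|lborel. \<bar>u x\<bar> * (\<bar>kslice R x y\<bar> * \<bar>v y\<bar>))"
    proof (rule Bochner_Integration.integral_cong[OF refl])
      fix y
      have "\<bar>logk x y * v y\<bar> = \<bar>kslice R x y * v y\<bar>" by (simp only: logk_mult_L2on[OF v])
      then show "\<bar>logk x y * (u x * v y)\<bar> = \<bar>u x\<bar> * (\<bar>kslice R x y\<bar> * \<bar>v y\<bar>)"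
        by (simp add: abs_mult mult_ac)
    qed
    also have "\<dots> = \<bar>u x\<bar> * I" unfolding I_def by simp
    finally show ?thesis using I I0 by (simp add: abs_mult mult.commute mult_right_mono)
  qed (simp add: L2onD(3)[OF u])
  show "integrable lborel (\<lambda>x. LINT y|lborel. norm (logk (fst (x, y)) (snd (x, y)) * (u (fst (x, y)) * v (snd (x, y)))))"
  proof (rule Bochner_Integration.integrable_bound)
    show "integrable lborel (\<lambda>x. c * \<bar>u x\<bar>)" using L2on_integrable[OF u] by simp
    show "AE x in lborel. norm (LINT y|lborel. norm (logk (fst (x, y)) (snd (x, y)) * (u (fst (x, y)) * v (snd (x, y)))))
        \<le> norm (c * \<bar>u x\<bar>)"
    proof (rule AE_I2)
      fix x
      show "norm (LINT y|lborel. norm (logk (fst (x, y)) (snd (x, y)) * (u (fst (x, y)) * v (snd (x, y)))))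
        \<le> norm (c * \<bar>u x\<bar>)"
        unfolding fst_conv snd_conv real_norm_def
        using inner[of x] abs_ge_self[of "c * \<bar>u x\<bar>"] by linarith
    qed
  qed measurable
qed

lemma energy_iterated:
  assumes R: "0 \<le> R" and u: "u \<in> L2on (cball 0 R)" and v: "v \<in> L2on (cball 0 R)"
  shows "energy u v = (LINT x|lborel. u x * logT v x)"
proof -
  have "energy u v = (LINT x|lborel. LINT y|lborel. logk x y * (u x * v y))"
    unfolding energy_def
    using lborel_pair.integral_fst'[OF energy_integrable[OF assms]] by simp
  also have "\<dots> = (LINT x|lborel. u x * logT v x)"
    unfolding logT_def by (simp add: mult.left_commute[of "logk _ _"])
  finally show ?thesis .
qed

lemma energy_commute:
  assumes "u \<in> borel_measurable borel" "v \<in> borel_measurable borel"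
  shows "energy u v = energy v u"
proof -
  note m = energy_integrand_measurable[OF assms]
  have "energy u v = (LINT z|(lborel \<Otimes>\<^sub>M lborel). logk (snd z) (fst z) * (u (snd z) * v (fst z)))"
    using lborel_pair.integral_product_swap[OF m] unfolding energy_def
    by (simp add: case_prod_unfold)
  then show ?thesis unfolding energy_def by (simp add: logk_commute mult.commute)
qed

lemma energy_scale_add_left:
  assumes "0 \<le> R" "u \<in> L2on (cball 0 R)" "v \<in> L2on (cball 0 R)" "w \<in> L2on (cball 0 R)"
  shows "energy (\<lambda>x. a * u x + b * v x) w = a * energy u w + b * energy v w"
proof -
  let ?M = "lborel \<Otimes>\<^sub>M (lborel :: (real^2) measure)"
  have "energy (\<lambda>x. a * u x + b * v x) w = (LINT z|?M. a * (logk (fst z) (snd z) * (u (fst z) * w (snd z)))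
      + b * (logk (fst z) (snd z) * (v (fst z) * w (snd z))))"
    unfolding energy_def by (intro Bochner_Integration.integral_cong) (auto simp: algebra_simps)
  also have "\<dots> = a * energy u w + b * energy v w"
    using energy_integrable[OF assms(1,2,4)] energy_integrable[OF assms(1,3,4)]
    unfolding energy_def by (subst Bochner_Integration.integral_add) auto
  finally show ?thesis .
qed

text \<open>The energy is a symmetric bilinear form; this is its expansion on a linear combination.\<close>

lemma energy_quadratic:
  assumes R: "0 \<le> R" and u: "u \<in> L2on (cball 0 R)" and v: "v \<in> L2on (cball 0 R)"
  shows "energy (\<lambda>x. a * u x + b * v x) (\<lambda>x. a * u x + b * v x)
    = a\<^sup>2 * energy u u + 2 * a * b * energy u v + b\<^sup>2 * energy v v"
proof -
  let ?w = "\<lambda>x. a * u x + b * v x"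
  note w = L2on_scale_add[OF u v, of a b]
  have "energy ?w ?w = a * energy u ?w + b * energy v ?w"
    by (rule energy_scale_add_left[OF R u v w])
  also have "energy u ?w = a * energy u u + b * energy v u"
    using energy_commute[OF L2onD(1)[OF u] L2onD(1)[OF w]] energy_scale_add_left[OF R u v u] by simp
  also have "energy v ?w = a * energy u v + b * energy v v"
    using energy_commute[OF L2onD(1)[OF v] L2onD(1)[OF w]] energy_scale_add_left[OF R u v v] by simp
  also have "energy v u = energy u v"
    by (rule energy_commute[OF L2onD(1)[OF v] L2onD(1)[OF u]])
  finally show ?thesis by (simp add: power2_eq_square algebra_simps)
qed

lemma energy_abs_le:
  assumes R: "0 \<le> R" and u: "u \<in> L2on (cball 0 R)"
  shows "\<bar>energy u u\<bar> \<le> (slice_bound R * pi * R\<^sup>2 + 1) * (LINT x|lborel. (u x)\<^sup>2)"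
proof -
  define N where "N = (LINT x|lborel. (u x)\<^sup>2)"
  have N0: "0 \<le> N" unfolding N_def by (intro integral_nonneg_AE) auto
  have le: "\<bar>u x * logT u x\<bar> \<le> (u x)\<^sup>2 + (slice_bound R * N) * indicator (cball 0 R) x" for x
  proof (cases "x \<in> cball 0 R")
    case True
    have "2 * \<bar>u x * logT u x\<bar> \<le> (u x)\<^sup>2 + (logT u x)\<^sup>2"
      using sum_squares_bound[of "\<bar>u x\<bar>" "\<bar>logT u x\<bar>"] by (simp add: abs_mult)
    moreover have "(logT u x)\<^sup>2 \<le> slice_bound R * N"
      unfolding N_def by (rule logT_square_le[OF R True u])
    moreover have "0 \<le> slice_bound R * N" using slice_bound_nonneg N0 by simp
    moreover have "0 \<le> (u x)\<^sup>2" by simp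
    ultimately have "\<bar>u x * logT u x\<bar> \<le> (u x)\<^sup>2 + slice_bound R * N" by linarith
    then show ?thesis using True by simp
  qed (simp add: L2onD(3)[OF u])
  have "\<bar>energy u u\<bar> \<le> (LINT x|lborel. \<bar>u x * logT u x\<bar>)"
    unfolding energy_iterated[OF R u u] by (rule integral_abs_bound)
  also have "\<dots> \<le> (LINT x|lborel. (u x)\<^sup>2 + (slice_bound R * N) * indicator (cball 0 R) x)"
  proof (rule integral_mono)
    have "(\<lambda>x. u x * logT u x) = (\<lambda>x. LINT y|lborel. logk x y * (u x * u y))"
      unfolding logT_def by (simp add: mult.left_commute[of "logk _ _"])
    then have "integrable lborel (\<lambda>x. u x * logT u x)"
      using lborel_pair.integrable_fst'[OF energy_integrable[OF R u u]] by simp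
    then show "integrable lborel (\<lambda>x. \<bar>u x * logT u x\<bar>)" by (rule integrable_abs)
    show "integrable lborel (\<lambda>x. (u x)\<^sup>2 + (slice_bound R * N) * indicator (cball 0 R) x)"
      using L2onD(2)[OF u] integrable_indicator_cball by auto
  qed (rule le)
  also have "\<dots> = N + (slice_bound R * N) * measure lborel (cball (0::real^2) R)"
    using L2onD(2)[OF u] integrable_indicator_cball unfolding N_def by (subst Bochner_Integration.integral_add) auto
  also have "measure lborel (cball (0::real^2) R) = pi * R\<^sup>2"
    using R by (simp add: content_cball eval_unit_ball_vol)
  finally show ?thesis unfolding N_def by (simp add: algebra_simps)
qed

text \<open>Dominated convergence, with the constant \<open>B\<close> on the disc as dominating function.\<close>

lemma energy_bounded_convergence:
  fixes v :: "nat \<Rightarrow> real^2 \<Rightarrow> real"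
  assumes R: "0 \<le> R"
    and m: "\<And>n. v n \<in> borel_measurable borel"
    and b: "\<And>n x. \<bar>v n x\<bar> \<le> B" and z: "\<And>n x. x \<notin> cball 0 R \<Longrightarrow> v n x = 0"
    and lim: "\<And>x. (\<lambda>n. v n x) \<longlonglongrightarrow> w x"
  shows "(\<lambda>n. energy (v n) (v n)) \<longlonglongrightarrow> energy w w"
    and "(\<lambda>n. LINT x|lborel. (v n x)\<^sup>2) \<longlonglongrightarrow> (LINT x|lborel. (w x)\<^sup>2)"
proof -
  have wm [measurable]: "w \<in> borel_measurable borel"
    by (rule borel_measurable_LIMSEQ_real[OF lim m])
  note m [measurable]
  define h :: "real^2 \<Rightarrow> real" where "h = (\<lambda>x. B * indicator (cball 0 R) x)"
  have vh: "\<bar>v n x\<bar> \<le> h x" for n x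
    using b[of n x] z[of x n] by (auto simp: h_def indicator_def)
  have "0 \<le> B" using b[of 0 0] by linarith
  then have h: "h \<in> L2on (cball 0 R)"
    by (intro bounded_L2on[where B = B and R = R]) (auto simp: h_def indicator_def)
  let ?M = "lborel \<Otimes>\<^sub>M (lborel :: (real^2) measure)"
  show "(\<lambda>n. energy (v n) (v n)) \<longlonglongrightarrow> energy w w"
    unfolding energy_def
  proof (rule integral_dominated_convergence)
    show "integrable ?M (\<lambda>z. \<bar>logk (fst z) (snd z) * (h (fst z) * h (snd z))\<bar>)"
      using energy_integrable[OF R h h] by (rule integrable_abs)
    show "AE z in ?M. norm (logk (fst z) (snd z) * (v n (fst z) * v n (snd z)))
        \<le> \<bar>logk (fst z) (snd z) * (h (fst z) * h (snd z))\<bar>" for n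
    proof (rule AE_I2)
      fix z :: "(real^2) \<times> (real^2)"
      have "\<bar>v n (fst z)\<bar> * \<bar>v n (snd z)\<bar> \<le> \<bar>h (fst z)\<bar> * \<bar>h (snd z)\<bar>"
        using vh by (intro mult_mono) (auto intro: order_trans[OF vh])
      then show "norm (logk (fst z) (snd z) * (v n (fst z) * v n (snd z)))
        \<le> \<bar>logk (fst z) (snd z) * (h (fst z) * h (snd z))\<bar>"
        unfolding real_norm_def abs_mult by (intro mult_left_mono) auto
    qed
    show "AE z in ?M. (\<lambda>n. logk (fst z) (snd z) * (v n (fst z) * v n (snd z)))
        \<longlonglongrightarrow> logk (fst z) (snd z) * (w (fst z) * w (snd z))"
      by (intro AE_I2 tendsto_intros lim)
  qed (rule energy_integrand_measurable; measurable)+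
  show "(\<lambda>n. LINT x|lborel. (v n x)\<^sup>2) \<longlonglongrightarrow> (LINT x|lborel. (w x)\<^sup>2)"
  proof (rule integral_dominated_convergence)
    show "integrable lborel (\<lambda>x. (h x)\<^sup>2)" by (rule L2onD(2)[OF h])
    show "AE x in lborel. (\<lambda>n. (v n x)\<^sup>2) \<longlonglongrightarrow> (w x)\<^sup>2"
      by (intro AE_I2 tendsto_intros lim)
    show "AE x in lborel. norm ((v n x)\<^sup>2) \<le> (h x)\<^sup>2" for n
    proof (rule AE_I2)
      fix x
      have "\<bar>v n x\<bar>\<^sup>2 \<le> (h x)\<^sup>2" using vh by (intro power_mono) auto
      then show "norm ((v n x)\<^sup>2) \<le> (h x)\<^sup>2" by simp
    qed
  qed measurable
qed

section \<open>The top of the spectrum\<close>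

text \<open>On a disc of diameter less than \<open>1\<close> the kernel is positive, so its indicator function has positive
energy. This makes the supremum in \<open>exists_top_eigenfunction\<close> positive, which is what keeps the limit
of a maximizing sequence from being zero.\<close>

lemma exists_positive_energy:
  assumes "open S" "S \<noteq> {}" "S \<subseteq> cball 0 R" "0 \<le> R"
  shows "\<exists>v\<in>L2on S. 0 < energy v v"
proof -
  obtain a e where "a \<in> S" "0 < e" "ball a e \<subseteq> S"
    using assms(1,2) open_contains_ball by (metis ex_in_conv)
  define r where "r = min e (1/4)"
  have r: "0 < r" "r \<le> 1/4" "ball a r \<subseteq> S"
    using \<open>0 < e\<close> \<open>ball a e \<subseteq> S\<close> by (auto simp: r_def)
  define v :: "real^2 \<Rightarrow> real" where "v = indicator (ball a r)"
  have vB: "v \<in> L2on (ball a r)" unfolding v_def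
    using r assms(3) by (intro indicator_L2on[of _ R]) auto
  have vS: "v \<in> L2on S" by (rule L2on_mono[OF r(3) vB])
  have vR: "v \<in> L2on (cball 0 R)" by (rule L2on_mono[OF assms(3) vS])
  define m where "m = measure lborel (ball a r)"
  have fin: "emeasure lborel (ball a r) < \<infinity>" by (rule emeasure_lborel_ball_finite)
  have m: "0 < m" unfolding m_def by (rule content_ball_pos[OF r(1)])
  have iv: "integrable lborel v" by (rule L2on_integrable[OF vR])
  have sv: "integral\<^sup>L lborel v = m" unfolding v_def m_def by simp
  have T: "ln 2 * m \<le> logT v x" if x: "x \<in> ball a r" for x
  proof -
    have xR: "x \<in> cball 0 R" using x r(3) assms(3) by blast
    have "(LINT y|lborel. ln 2 * v y) \<le> (LINT y|lborel. logk x y * v y)"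
    proof (rule integral_mono_AE)
      show "integrable lborel (\<lambda>y. logk x y * v y)" by (rule logT_integrable[OF assms(4) xR vR])
      show "AE y in lborel. ln 2 * v y \<le> logk x y * v y"
        using AE_lborel_singleton[of x]
      proof eventually_elim
        case (elim y)
        show ?case
        proof (cases "y \<in> ball a r")
          case True
          have "dist x y \<le> dist a x + dist a y" by (rule dist_triangle3)
          then have "norm (x - y) \<le> 1/2" using x True r(2) by (simp add: dist_norm)
          then have "2 \<le> 1 / norm (x - y)" using elim by (simp add: field_simps)
          then have "ln 2 \<le> logk x y" unfolding logk_def by (subst ln_le_cancel_iff) auto
          then show ?thesis using True by (simp add: v_def)
        qed (simp add: v_def)
      qed
    qed (use iv in simp)
    then show ?thesis using iv sv by (simp add: logT_def)
  qed
  have "energy v v = (LINT x|lborel. v x * logT v x)"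
    by (rule energy_iterated[OF assms(4) vR vR])
  also have "\<dots> \<ge> (LINT x|lborel. (ln 2 * m) * v x)"
  proof (rule integral_mono)
    have "(\<lambda>x. v x * logT v x) = (\<lambda>x. LINT y|lborel. logk x y * (v x * v y))"
      unfolding logT_def by (simp add: mult.left_commute[of "logk _ _"])
    then show "integrable lborel (\<lambda>x. v x * logT v x)"
      using lborel_pair.integrable_fst'[OF energy_integrable[OF assms(4) vR vR]] by simp
    show "(ln 2 * m) * v x \<le> v x * logT v x" for x
      using T[of x] by (cases "x \<in> ball a r") (auto simp: v_def)
  qed (use iv in simp)
  moreover have "(LINT x|lborel. (ln 2 * m) * v x) = ln 2 * m * m"
    using sv by simp
  moreover have "0 < ln 2 * m * m" using m by simp
  ultimately show ?thesis using vS by (intro bexI[of _ v]) auto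
qed

text \<open>Let \<open>M\<close> be the supremum of the energy on the unit sphere and \<open>u\<^sub>n\<close> a maximizing sequence. The form
\<open>M \<langle>u, v\<rangle> - E(u, v)\<close> is positive semidefinite and tends to \<open>0\<close> at \<open>(u\<^sub>n, u\<^sub>n)\<close>, so by the
Cauchy--Schwarz inequality it tends to \<open>0\<close> at \<open>(u\<^sub>n, q)\<close> for each fixed \<open>q\<close>. With the slice of the
kernel at \<open>x\<close> as \<open>q\<close> this says \<open>M T u\<^sub>n(x) - T T u\<^sub>n(x) \<rightarrow> 0\<close>, where \<open>T\<close> is the potential restricted
to \<open>S\<close>. By Arzela--Ascoli \<open>T u\<^sub>n\<close> has a uniformly convergent subsequence, and its limit is an
eigenfunction.\<close>

lemma exists_top_eigenfunction:
  fixes S :: "(real^2) set"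
  assumes S: "open S" "S \<noteq> {}" "S \<subseteq> cball 0 R" and R: "0 \<le> R"
  shows "\<exists>M>0. (\<forall>u\<in>L2on S. energy u u \<le> M * (LINT x|lborel. (u x)\<^sup>2)) \<and>
    (\<exists>w\<in>L2on S. (LINT x|lborel. (w x)\<^sup>2) > 0 \<and> (\<forall>x\<in>S. logT w x = M * w x))"
proof -
  define C where "C = slice_bound R * pi * R\<^sup>2 + 1"
  define nn where "nn u = (LINT x|lborel. (u x)\<^sup>2)" for u :: "real^2 \<Rightarrow> real"
  define A where "A = {energy u u | u. u \<in> L2on S \<and> nn u = 1}"
  define M where "M = Sup A"
  note SR = L2on_mono[OF S(3)]
  have [measurable]: "S \<in> sets borel" using S(1) by simp
  have nn0: "0 \<le> nn u" for u unfolding nn_def by (intro integral_nonneg_AE) auto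
  have E_abs: "\<bar>energy u u\<bar> \<le> C * nn u" if "u \<in> L2on S" for u
    unfolding C_def nn_def by (rule energy_abs_le[OF R SR[OF that]])
  have nn_scale: "nn (\<lambda>x. a * u x + 0 * u x) = a\<^sup>2 * nn u" for a u
    unfolding nn_def by (simp add: power_mult_distrib)
  have normalized: "energy u u / nn u \<in> A" if u: "u \<in> L2on S" and pos: "0 < nn u" for u
  proof -
    define a where "a = 1 / sqrt (nn u)"
    have a2: "a\<^sup>2 = 1 / nn u" using pos by (simp add: a_def power_divide)
    let ?u = "\<lambda>x. a * u x + 0 * u x"
    have eq: "energy ?u ?u = energy u u / nn u"
      using energy_quadratic[OF R SR[OF u] SR[OF u], of a 0] a2 by simp
    have uS: "?u \<in> L2on S" by (rule L2on_scale_add[OF u u])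
    have "nn ?u = 1" using nn_scale a2 pos by simp
    with uS have "energy ?u ?u \<in> A" unfolding A_def by (intro CollectI exI[of _ ?u] conjI refl)
    then show ?thesis by (simp only: eq)
  qed
  obtain v where v: "v \<in> L2on S" "0 < energy v v"
    using exists_positive_energy[OF S R] by blast
  have "0 < nn v" using E_abs[OF v(1)] v(2) nn0[of v] by (cases "nn v = 0") auto
  have bdd: "bdd_above A"
  proof (rule bdd_aboveI)
    show "x \<le> C" if "x \<in> A" for x
      using that E_abs unfolding A_def by fastforce
  qed
  have M_pos: "0 < M"
  proof -
    have "0 < energy v v / nn v" using v(2) \<open>0 < nn v\<close> by simp
    also have "\<dots> \<le> M" unfolding M_def
      by (rule cSup_upper[OF normalized[OF v(1) \<open>0 < nn v\<close>] bdd])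
    finally show ?thesis .
  qed
  have le_M: "energy u u \<le> M * nn u" if u: "u \<in> L2on S" for u
  proof (cases "nn u = 0")
    case True
    then show ?thesis using E_abs[OF u] by simp
  next
    case False
    then have pos: "0 < nn u" using nn0[of u] by simp
    have "energy u u / nn u \<le> M" unfolding M_def
      by (rule cSup_upper[OF normalized[OF u pos] bdd])
    then show ?thesis using pos by (simp add: field_simps)
  qed
  \<comment> \<open>the form \<open>M \<langle>u, v\<rangle> - energy u v\<close> is positive semidefinite, hence satisfies Cauchy--Schwarz\<close>
  define B where "B u v = M * (LINT x|lborel. u x * v x) - energy u v" for u v
  have B_CS: "(B u v)\<^sup>2 \<le> B u u * B v v" if u: "u \<in> L2on S" and v: "v \<in> L2on S" for u v
  proof (rule quadratic_nonneg_discriminant)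
    fix t
    let ?w = "\<lambda>x. 1 * u x + t * v x"
    have "nn ?w = (LINT x|lborel. (u x)\<^sup>2 + (2 * t) * (u x * v x) + t\<^sup>2 * (v x)\<^sup>2)"
      unfolding nn_def by (intro Bochner_Integration.integral_cong) (auto simp: power2_eq_square algebra_simps)
    also have "\<dots> = nn u + 2 * t * (LINT x|lborel. u x * v x) + t\<^sup>2 * nn v"
      unfolding nn_def using L2onD(2)[OF u] L2onD(2)[OF v] L2on_integrable_mult[OF u v] by simp
    finally have nw: "nn ?w = nn u + 2 * t * (LINT x|lborel. u x * v x) + t\<^sup>2 * nn v" .
    have Ew: "energy ?w ?w = energy u u + 2 * t * energy u v + t\<^sup>2 * energy v v"
      using energy_quadratic[OF R SR[OF u] SR[OF v], of 1 t] by simp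
    have "0 \<le> M * nn ?w - energy ?w ?w"
      using le_M[OF L2on_scale_add[OF u v, of 1 t]] by simp
    also have "\<dots> = B u u + 2 * B u v * t + B v v * t\<^sup>2"
      unfolding nw Ew unfolding B_def nn_def by (simp add: power2_eq_square algebra_simps)
    finally show "0 \<le> B u u + 2 * B u v * t + B v v * t\<^sup>2" .
  qed
  have "\<exists>u. u \<in> L2on S \<and> nn u = 1 \<and> M - 1 / real (Suc n) < energy u u" for n
  proof -
    have "M - 1 / real (Suc n) < Sup A" unfolding M_def by simp
    moreover have "A \<noteq> {}" using normalized[OF v(1) \<open>0 < nn v\<close>] by blast
    ultimately obtain a where "a \<in> A" "M - 1 / real (Suc n) < a"
      using less_cSup_iff[OF _ bdd] by blast
    then show ?thesis unfolding A_def by blast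
  qed
  then obtain u where u: "\<And>n. u n \<in> L2on S" "\<And>n. nn (u n) = 1"
    and uM: "\<And>n. M - 1 / real (Suc n) < energy (u n) (u n)"
    by metis
  define F where "F n = logT (u n)" for n
  have F_meas [measurable]: "F n \<in> borel_measurable borel" for n
    unfolding F_def by (intro logT_measurable L2onD(1)[OF u(1)])
  have F_bd: "\<bar>F n x\<bar> \<le> sqrt (slice_bound R)" if "x \<in> cball 0 R" for n x
  proof -
    have "(F n x)\<^sup>2 \<le> slice_bound R"
      using logT_square_le[OF R that SR[OF u(1)[of n]]] u(2)[of n] by (simp add: F_def nn_def)
    then show ?thesis using real_le_rsqrt[of "\<bar>F n x\<bar>"] by simp
  qed
  have F_eq: "\<bar>F n x - F n y\<bar> < e"
    if "x \<in> cball 0 R" "y \<in> cball 0 R" "0 < e" "norm (x - y) < e\<^sup>2 / Hoelder_const R" for n x y e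
  proof -
    have "(F n x - F n y)\<^sup>2 \<le> Hoelder_const R * norm (x - y)"
      using logT_Hoelder[OF R that(1,2) SR[OF u(1)[of n]]] u(2)[of n] by (simp add: F_def nn_def)
    also have "\<dots> < e\<^sup>2" using that(4) Hoelder_const_pos[of R] by (simp add: field_simps)
    finally have "\<bar>F n x - F n y\<bar>\<^sup>2 < e\<^sup>2" by simp
    then show ?thesis using that(3) by (rule power2_less_imp_less[OF _ less_imp_le])
  qed
  obtain g k where g: "continuous_on (cball 0 R) g" and k: "strict_mono (k :: nat \<Rightarrow> nat)"
    and conv: "\<And>e. 0 < e \<Longrightarrow> \<exists>N. \<forall>n x. n \<ge> N \<and> x \<in> cball 0 R \<longrightarrow> norm (F (k n) x - g x) < e"
  proof (rule Arzela_Ascoli[of "cball (0::real^2) R" F "sqrt (slice_bound R)"])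
    show "\<exists>d>0. \<forall>n y. y \<in> cball 0 R \<and> norm (x - y) < d \<longrightarrow> norm (F n x - F n y) < e"
      if "x \<in> cball 0 R" "0 < e" for x e
      using F_eq[OF that(1) _ that(2)] that(2) Hoelder_const_pos[of R]
      by (intro exI[of _ "e\<^sup>2 / Hoelder_const R"]) auto
  qed (use F_bd in auto)
  have lim: "(\<lambda>n. F (k n) x) \<longlonglongrightarrow> g x" if "x \<in> cball 0 R" for x
    unfolding LIMSEQ_iff using conv that by meson
  \<comment> \<open>The functions \<open>F n\<close> live on the whole disc; the operator on \<open>S\<close> sees their restrictions.\<close>
  define P where "P n x = indicator S x * F (k n) x" for n x
  define w where "w x = indicator S x * g x" for x
  have P_lim: "(\<lambda>n. P n x) \<longlonglongrightarrow> w x" for x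
    using lim[of x] S(3) unfolding P_def w_def
    by (cases "x \<in> S") (auto intro: tendsto_intros)
  have P_bd: "\<bar>P n x\<bar> \<le> sqrt (slice_bound R)" for n x
    using F_bd[of x] S(3) slice_bound_nonneg[of R] unfolding P_def by (cases "x \<in> S") auto
  have P_meas [measurable]: "P n \<in> borel_measurable borel" for n
    unfolding P_def by measurable
  have P_off: "P n x = 0" if "x \<notin> S" for n x using that by (simp add: P_def)
  have w_meas [measurable]: "w \<in> borel_measurable borel"
    by (rule borel_measurable_LIMSEQ_real[OF P_lim P_meas])
  have w_bd: "\<bar>w x\<bar> \<le> sqrt (slice_bound R)" for x
    by (rule LIMSEQ_le_const2[OF tendsto_rabs[OF P_lim]]) (use P_bd in blast)
  have wS: "w \<in> L2on S"
    by (rule bounded_L2on[OF w_meas w_bd _ S(3)]) (simp add: w_def)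
  have PS: "P n \<in> L2on S" for n
    by (rule bounded_L2on[OF P_meas P_bd P_off S(3)])
  have nnP: "(\<lambda>n. nn (P n)) \<longlonglongrightarrow> nn w"
    unfolding nn_def
    by (rule energy_bounded_convergence(2)[OF R P_meas P_bd _ P_lim]) (use P_off S(3) in blast)
  have E_lim: "(\<lambda>n. energy (u (k n)) (u (k n))) \<longlonglongrightarrow> M"
  proof -
    have "(\<lambda>n. energy (u n) (u n)) \<longlonglongrightarrow> M"
    proof (rule tendsto_sandwich)
      show "(\<lambda>n. M - 1 / real (Suc n)) \<longlonglongrightarrow> M"
        using LIMSEQ_inverse_real_of_nat_add_minus[of M] by (simp add: inverse_eq_divide)
      show "\<forall>\<^sub>F n in sequentially. energy (u n) (u n) \<le> M"
        using le_M[OF u(1)] u(2) by simp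
    qed (use uM in \<open>auto intro!: always_eventually less_imp_le\<close>)
    then show ?thesis using LIMSEQ_subseq_LIMSEQ[OF _ k] by (auto simp: o_def)
  qed
  \<comment> \<open>The limit is not zero: \<open>E(u\<^sub>n, u\<^sub>n) = \<langle>u\<^sub>n, P\<^sub>n\<rangle>\<close> is at most the norm of \<open>P\<^sub>n\<close>, and tends to \<open>M\<close>.\<close>
  have "M\<^sup>2 \<le> nn w"
  proof (rule LIMSEQ_le[OF tendsto_power[OF E_lim] nnP], intro exI allI impI)
    fix n
    note un = u(1)[of "k n"]
    have "energy (u (k n)) (u (k n)) = (LINT x|lborel. u (k n) x * P n x)"
      unfolding energy_iterated[OF R SR[OF un] SR[OF un]] P_def F_def
      by (intro Bochner_Integration.integral_cong) (use L2onD(3)[OF un] in \<open>auto simp: indicator_def\<close>)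
    also have "\<dots>\<^sup>2 \<le> nn (u (k n)) * nn (P n)" unfolding nn_def
      using L2onD(1,2)[OF un] L2onD(1,2)[OF PS[of n]] by (intro Cauchy_Schwarz_integral) auto
    finally show "(energy (u (k n)) (u (k n)))\<^sup>2 \<le> nn (P n)" using u(2) by simp
  qed
  then have w_pos: "0 < nn w" using zero_less_power[OF M_pos, of 2] by linarith
  have eig: "logT w x = M * w x" if x: "x \<in> S" for x
  proof -
    have xR: "x \<in> cball 0 R" using x S(3) by blast
    define q where "q y = indicator S y * kslice R x y" for y
    have qmeas [measurable]: "q \<in> borel_measurable borel" unfolding q_def by measurable
    have q_int: "integrable lborel (\<lambda>y. (q y)\<^sup>2)"
      by (rule Bochner_Integration.integrable_bound[OF kslice_square_integrable[OF R xR]])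
        (auto simp: q_def indicator_def)
    have qS: "q \<in> L2on S" using q_int by (auto simp: L2on_def q_def)
    have "B q q * (1 / real (Suc n)) \<ge> (M * F n x - logT (\<lambda>y. indicator S y * F n y) x)\<^sup>2" for n
    proof -
      have FS: "(\<lambda>y. indicator S y * F n y) \<in> L2on S"
        using F_bd[of _ n] S(3) slice_bound_nonneg[of R]
        by (intro bounded_L2on[where R = R and B = "sqrt (slice_bound R)"]) (auto simp: indicator_def)
      have eq1: "(LINT y|lborel. u n y * q y) = F n x"
        unfolding F_def logT_kslice[OF SR[OF u(1)]] q_def
        by (intro Bochner_Integration.integral_cong)
          (use L2onD(3)[OF u(1)[of n]] in \<open>auto simp: indicator_def\<close>)
      have "energy (u n) q = energy q (u n)"
        by (rule energy_commute[OF L2onD(1)[OF u(1)] qmeas])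
      also have "\<dots> = (LINT y|lborel. q y * F n y)"
        unfolding F_def by (rule energy_iterated[OF R SR[OF qS] SR[OF u(1)]])
      also have "\<dots> = (LINT y|lborel. kslice R x y * (indicator S y * F n y))"
        unfolding q_def by (simp add: mult_ac)
      also have "\<dots> = logT (\<lambda>y. indicator S y * F n y) x"
        by (rule logT_kslice[OF SR[OF FS], symmetric])
      finally have "B (u n) q = M * F n x - logT (\<lambda>y. indicator S y * F n y) x"
        using eq1 by (simp add: B_def)
      then have "(M * F n x - logT (\<lambda>y. indicator S y * F n y) x)\<^sup>2 \<le> B (u n) (u n) * B q q"
        using B_CS[OF u(1) qS] by metis
      also have "\<dots> \<le> (1 / real (Suc n)) * B q q"
      proof (rule mult_right_mono)
        have "B (u n) (u n) = M - energy (u n) (u n)"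
          using u(2)[of n] unfolding B_def nn_def by (simp add: power2_eq_square)
        then show "B (u n) (u n) \<le> 1 / real (Suc n)" using uM[of n] by simp
        show "0 \<le> B q q"
          using le_M[OF qS] unfolding B_def nn_def by (simp add: power2_eq_square)
      qed
      finally show ?thesis by (simp add: mult.commute)
    qed
    then have small: "(M * F (k n) x - logT (P n) x)\<^sup>2 \<le> B q q * (1 / real (Suc (k n)))" for n
      unfolding P_def by blast
    have "(\<lambda>n. logT (P n) x) \<longlonglongrightarrow> logT w x"
      unfolding logT_def
    proof (rule integral_dominated_convergence)
      define h :: "real^2 \<Rightarrow> real" where "h y = sqrt (slice_bound R) * indicator (cball 0 R) y" for y
      have [measurable]: "h \<in> borel_measurable borel" unfolding h_def by measurable
      have h: "h \<in> L2on (cball 0 R)"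
        using slice_bound_nonneg[of R]
        by (intro bounded_L2on[where R = R and B = "sqrt (slice_bound R)"]) (auto simp: indicator_def h_def)
      show "integrable lborel (\<lambda>y. \<bar>logk x y * h y\<bar>)"
        using logT_integrable[OF R xR h] by (rule integrable_abs)
      have "\<bar>P n y\<bar> \<le> \<bar>h y\<bar>" for n y
      proof (cases "y \<in> cball 0 R")
        case True
        then show ?thesis using P_bd[of n y] by (simp add: h_def)
      next
        case False
        then have "y \<notin> S" using S(3) by blast
        then show ?thesis using P_off by simp
      qed
      then show "AE y in lborel. norm (logk x y * P n y) \<le> \<bar>logk x y * h y\<bar>" for n
        by (intro AE_I2) (auto simp: abs_mult intro: mult_left_mono)
      show "AE y in lborel. (\<lambda>n. logk x y * P n y) \<longlonglongrightarrow> logk x y * w y"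
        by (intro AE_I2 tendsto_intros P_lim)
    qed measurable
    then have l1: "(\<lambda>n. (M * F (k n) x - logT (P n) x)\<^sup>2) \<longlonglongrightarrow> (M * g x - logT w x)\<^sup>2"
      by (intro tendsto_intros lim xR)
    have l2: "(\<lambda>n. B q q * (1 / real (Suc (k n)))) \<longlonglongrightarrow> B q q * 0"
    proof (rule tendsto_mult_left)
      have "(\<lambda>n. 1 / real (Suc n)) \<longlonglongrightarrow> 0"
        using LIMSEQ_inverse_real_of_nat by (simp add: inverse_eq_divide)
      then show "(\<lambda>n. 1 / real (Suc (k n))) \<longlonglongrightarrow> 0"
        using LIMSEQ_subseq_LIMSEQ[OF _ k] by (auto simp: o_def)
    qed
    have "(M * g x - logT w x)\<^sup>2 \<le> B q q * 0"
      by (rule LIMSEQ_le[OF l1 l2]) (use small in auto)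
    then have "M * g x = logT w x" by simp
    then show ?thesis using x by (simp add: w_def)
  qed
  show ?thesis
    using M_pos le_M wS w_pos eig unfolding nn_def by blast
qed


section \<open>Eigenfunctions of the logarithmic potential\<close>

lemma L2on_of_square_integrable_on:
  assumes O: "open \<Omega>" and u: "square_integrable_on u \<Omega>"
  shows "\<exists>v\<in>L2on \<Omega>. (AE x in lborel. x \<in> \<Omega> \<longrightarrow> u x = v x) \<and>
    (\<forall>x. log_potential \<Omega> u x = logT v x / (2 * pi))"
proof -
  have Ob [measurable]: "\<Omega> \<in> sets borel" using O by simp
  then have Ol: "\<Omega> \<inter> space lebesgue \<in> sets lebesgue" by simp
  have um: "u \<in> borel_measurable (lebesgue_on \<Omega>)"
    and ui: "integrable (lebesgue_on \<Omega>) (\<lambda>x. (u x)\<^sup>2)"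
    using u by (auto simp: square_integrable_on_def)
  have "(\<lambda>x. indicator \<Omega> x *\<^sub>R u x) \<in> borel_measurable lebesgue"
    using um borel_measurable_restrict_space_iff[OF Ol, of u] by simp
  then obtain g where g [measurable]: "g \<in> borel_measurable lborel"
    and ug: "AE x in lborel. indicator \<Omega> x *\<^sub>R u x = g x"
    using completion_ex_borel_measurable_real by blast
  define v where "v x = indicator \<Omega> x * g x" for x
  have vm [measurable]: "v \<in> borel_measurable borel" using g unfolding v_def by measurable
  have uv: "AE x in lborel. indicator \<Omega> x * u x = v x"
    using ug by eventually_elim (auto simp: v_def indicator_def)
  have "integrable lebesgue (\<lambda>x. indicator \<Omega> x *\<^sub>R (u x)\<^sup>2)"
    using ui by (simp only: integrable_restrict_space[OF Ol])
  moreover have "AE x in lebesgue. indicator \<Omega> x *\<^sub>R (u x)\<^sup>2 = (v x)\<^sup>2"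
    using AE_completion[OF uv] by eventually_elim (auto simp: v_def indicator_def)
  moreover have "(\<lambda>x. (v x)\<^sup>2) \<in> borel_measurable lebesgue"
    by (rule measurable_completion) measurable
  ultimately have "integrable lebesgue (\<lambda>x. (v x)\<^sup>2)"
    using borel_measurable_integrable by (subst integrable_cong_AE[symmetric]) auto
  then have "integrable lborel (\<lambda>x. (v x)\<^sup>2)"
    by (subst (asm) integrable_completion) auto
  then have vL: "v \<in> L2on \<Omega>" by (auto simp: L2on_def v_def)
  have "log_potential \<Omega> u x = logT v x / (2 * pi)" for x
  proof -
    have "(LINT y|lebesgue_on \<Omega>. ln (1 / norm (x - y)) * u y)
        = (LINT y|lebesgue. indicator \<Omega> y *\<^sub>R (ln (1 / norm (x - y)) * u y))"
      by (rule integral_restrict_space[OF Ol])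
    also have "\<dots> = (LINT y|lebesgue. logk x y * (indicator \<Omega> y *\<^sub>R u y))"
      by (simp add: logk_def mult_ac)
    also have "\<dots> = (LINT y|lebesgue. logk x y * v y)"
    proof (rule integral_cong_AE)
      have lm: "(\<lambda>y. logk x y) \<in> borel_measurable lebesgue"
        by (rule measurable_completion) measurable
      then show "(\<lambda>y. logk x y * (indicator \<Omega> y *\<^sub>R u y)) \<in> borel_measurable lebesgue"
        using \<open>(\<lambda>x. indicator \<Omega> x *\<^sub>R u x) \<in> borel_measurable lebesgue\<close>
        by (rule borel_measurable_times)
      show "(\<lambda>y. logk x y * v y) \<in> borel_measurable lebesgue"
        by (rule measurable_completion) measurable
      show "AE y in lebesgue. logk x y * (indicator \<Omega> y *\<^sub>R u y) = logk x y * v y"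
        using AE_completion[OF uv] by eventually_elim auto
    qed
    also have "\<dots> = logT v x"
      unfolding logT_def by (rule integral_completion) measurable
    finally show ?thesis unfolding log_potential_def by simp
  qed
  moreover have "AE x in lborel. x \<in> \<Omega> \<longrightarrow> u x = v x"
    using uv by eventually_elim auto
  ultimately show ?thesis using vL by blast
qed

lemma square_integrable_on_of_L2on:
  assumes O: "open \<Omega>" and u: "u \<in> L2on \<Omega>"
  shows "square_integrable_on u \<Omega>" "log_potential \<Omega> u x = logT u x / (2 * pi)"
proof -
  have Ob: "\<Omega> \<inter> space lebesgue \<in> sets lebesgue" using O by simp
  note um [measurable] = L2onD(1)[OF u]
  have ind: "indicator \<Omega> y *\<^sub>R u y = u y" "indicator \<Omega> y * u y = u y" for y
    using L2onD(3)[OF u, of y] by (auto simp: indicator_def)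
  have ind2: "indicator \<Omega> y *\<^sub>R (u y)\<^sup>2 = (u y)\<^sup>2" for y
    using L2onD(3)[OF u, of y] by (auto simp: indicator_def)
  have "u \<in> borel_measurable lebesgue" by (rule measurable_completion) measurable
  moreover have "integrable lebesgue (\<lambda>x. (u x)\<^sup>2)"
    using L2onD(2)[OF u] by (subst integrable_completion) auto
  ultimately show "square_integrable_on u \<Omega>"
    unfolding square_integrable_on_def
      borel_measurable_restrict_space_iff[OF Ob] integrable_restrict_space[OF Ob] ind ind2
    by blast
  have "(LINT y|lebesgue_on \<Omega>. ln (1 / norm (x - y)) * u y)
      = (LINT y|lebesgue. indicator \<Omega> y *\<^sub>R (ln (1 / norm (x - y)) * u y))"
    by (rule integral_restrict_space[OF Ob])
  also have "\<dots> = (LINT y|lebesgue. logk x y * u y)"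
    by (intro Bochner_Integration.integral_cong)
      (use L2onD(3)[OF u] in \<open>auto simp: logk_def indicator_def\<close>)
  also have "\<dots> = logT u x"
    unfolding logT_def by (rule integral_completion) measurable
  finally show "log_potential \<Omega> u x = logT u x / (2 * pi)"
    unfolding log_potential_def by simp
qed

lemma AE_lebesgue_on_open_iff:
  fixes \<Omega> :: "(real^2) set"
  assumes "open \<Omega>"
  shows "(AE x in lebesgue_on \<Omega>. P x) \<longleftrightarrow> (AE x in lborel. x \<in> \<Omega> \<longrightarrow> P x)"
proof -
  have "\<Omega> \<inter> space lebesgue \<in> sets lebesgue" using assms by simp
  from AE_restrict_space_iff[OF this] show ?thesis
    by (simp add: AE_completion_iff)
qed

text \<open>The energy identity is the eigenvalue equation integrated against the eigenfunction.\<close>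

lemma log_eigenfunction_L2on:
  assumes O: "open \<Omega>" "\<Omega> \<subseteq> cball 0 R" "0 \<le> R" and e: "log_eigenfunction \<Omega> \<tau> u"
  obtains v where "v \<in> L2on \<Omega>" "AE x in lborel. x \<in> \<Omega> \<longrightarrow> u x = v x"
    "AE x in lborel. x \<in> \<Omega> \<longrightarrow> logT v x = 2 * pi * \<tau> * v x"
    "0 < (LINT x|lborel. (v x)\<^sup>2)"
    "energy v v = 2 * pi * \<tau> * (LINT x|lborel. (v x)\<^sup>2)"
proof -
  have sq: "square_integrable_on u \<Omega>"
    and nz: "\<not> (AE x in lborel. x \<in> \<Omega> \<longrightarrow> u x = 0)"
    and ev: "AE x in lborel. x \<in> \<Omega> \<longrightarrow> log_potential \<Omega> u x = \<tau> * u x"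
    using e unfolding log_eigenfunction_def AE_lebesgue_on_open_iff[OF O(1)] by auto
  obtain v where v: "v \<in> L2on \<Omega>" and uv: "AE x in lborel. x \<in> \<Omega> \<longrightarrow> u x = v x"
    and T: "\<And>x. log_potential \<Omega> u x = logT v x / (2 * pi)"
    using L2on_of_square_integrable_on[OF O(1) sq] by blast
  note vR = L2on_mono[OF O(2) v]
  have Tv: "AE x in lborel. x \<in> \<Omega> \<longrightarrow> logT v x = 2 * pi * \<tau> * v x"
    using ev uv by eventually_elim (auto simp: T field_simps)
  have "(LINT x|lborel. (v x)\<^sup>2) \<noteq> 0"
  proof
    assume "(LINT x|lborel. (v x)\<^sup>2) = 0"
    then have "AE x in lborel. (v x)\<^sup>2 = 0"
      using integral_nonneg_eq_0_iff_AE[OF L2onD(2)[OF v]] by simp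
    with uv have "AE x in lborel. x \<in> \<Omega> \<longrightarrow> u x = 0"
      by eventually_elim auto
    then show False using nz by simp
  qed
  moreover have "0 \<le> (LINT x|lborel. (v x)\<^sup>2)" by (intro integral_nonneg_AE) auto
  ultimately have pos: "0 < (LINT x|lborel. (v x)\<^sup>2)" by linarith
  note [measurable] = L2onD(1)[OF v]
  have "energy v v = (LINT x|lborel. v x * logT v x)"
    by (rule energy_iterated[OF O(3) vR vR])
  also have "\<dots> = (LINT x|lborel. (2 * pi * \<tau>) * (v x)\<^sup>2)"
  proof (rule integral_cong_AE)
    show "AE x in lborel. v x * logT v x = 2 * pi * \<tau> * (v x)\<^sup>2"
      using Tv
    proof eventually_elim
      case (elim x)
      show ?case
        using elim L2onD(3)[OF v, of x] by (cases "x \<in> \<Omega>") (simp_all add: power2_eq_square)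
    qed
  qed measurable
  also have "\<dots> = 2 * pi * \<tau> * (LINT x|lborel. (v x)\<^sup>2)" by simp
  finally show ?thesis using that v uv Tv pos by blast
qed

text \<open>The number \<open>M\<close> of \<open>exists_top_eigenfunction\<close> is \<open>2\<pi>\<close> times an eigenvalue, and no eigenvalue is
larger because an eigenfunction is a test function for its own eigenvalue. So the greatest eigenvalue
exists and bounds the energy.\<close>

theorem tau1_variational:
  assumes O: "open \<Omega>" "\<Omega> \<noteq> {}" "bounded \<Omega>"
  shows "0 < tau1 \<Omega>"
    and "u \<in> L2on \<Omega> \<Longrightarrow> energy u u \<le> 2 * pi * tau1 \<Omega> * (LINT x|lborel. (u x)\<^sup>2)"
proof -
  obtain R where R: "0 \<le> R" "\<Omega> \<subseteq> cball 0 R" by (rule bounded_subset_cball_0[OF O(3)])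
  obtain M w where M: "0 < M" and le: "\<And>u. u \<in> L2on \<Omega> \<Longrightarrow> energy u u \<le> M * (LINT x|lborel. (u x)\<^sup>2)"
    and w: "w \<in> L2on \<Omega>" "0 < (LINT x|lborel. (w x)\<^sup>2)" and Tw: "\<And>x. x \<in> \<Omega> \<Longrightarrow> logT w x = M * w x"
    using exists_top_eigenfunction[OF O(1,2) R(2,1)] by blast
  have "tau1 \<Omega> = M / (2 * pi)"
    unfolding tau1_def
  proof (rule Greatest_equality)
    have "\<not> (AE x in lborel. x \<in> \<Omega> \<longrightarrow> w x = 0)"
    proof
      assume "AE x in lborel. x \<in> \<Omega> \<longrightarrow> w x = 0"
      then have "AE x in lborel. (w x)\<^sup>2 = 0"
      proof eventually_elim
        case (elim x)
        then show ?case using L2onD(3)[OF w(1), of x] by (cases "x \<in> \<Omega>") auto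
      qed
      then have "(LINT x|lborel. (w x)\<^sup>2) = 0"
        by (rule integral_eq_zero_AE)
      then show False using w(2) by simp
    qed
    moreover have "AE x in lborel. x \<in> \<Omega> \<longrightarrow> log_potential \<Omega> w x = M / (2 * pi) * w x"
      using square_integrable_on_of_L2on(2)[OF O(1) w(1)] Tw by simp
    ultimately show "log_eigenvalue \<Omega> (M / (2 * pi))"
      unfolding log_eigenvalue_def log_eigenfunction_def AE_lebesgue_on_open_iff[OF O(1)]
      using square_integrable_on_of_L2on(1)[OF O(1) w(1)] by blast
    fix \<tau> assume "log_eigenvalue \<Omega> \<tau>"
    then obtain u where "log_eigenfunction \<Omega> \<tau> u" unfolding log_eigenvalue_def by blast
    then obtain v where v: "v \<in> L2on \<Omega>" "0 < (LINT x|lborel. (v x)\<^sup>2)"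
      "energy v v = 2 * pi * \<tau> * (LINT x|lborel. (v x)\<^sup>2)"
      by (rule log_eigenfunction_L2on[OF O(1) R(2,1)])
    have "2 * pi * \<tau> * (LINT x|lborel. (v x)\<^sup>2) \<le> M * (LINT x|lborel. (v x)\<^sup>2)"
      using le[OF v(1)] v(3) by simp
    then have "2 * pi * \<tau> \<le> M" using v(2) by (simp add: mult_le_cancel_right)
    then show "\<tau> \<le> M / (2 * pi)" by (simp add: field_simps)
  qed
  then show "0 < tau1 \<Omega>"
    and "u \<in> L2on \<Omega> \<Longrightarrow> energy u u \<le> 2 * pi * tau1 \<Omega> * (LINT x|lborel. (u x)\<^sup>2)"
    using M le by auto
qed

section \<open>Polarization\<close>

lemma energy_isometry:
  fixes T :: "real^2 \<Rightarrow> real^2"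
  assumes Tm [measurable]: "T \<in> borel_measurable borel" and T: "distr lborel borel T = lborel"
    and iso: "\<And>x y. norm (T x - T y) = norm (x - y)"
    and [measurable]: "u \<in> borel_measurable borel" "v \<in> borel_measurable borel"
  shows "energy (\<lambda>x. u (T x)) (\<lambda>x. v (T x)) = energy u v"
proof -
  let ?M = "lborel \<Otimes>\<^sub>M (lborel :: (real^2) measure)"
  let ?g = "\<lambda>z. logk (fst z) (snd z) * (u (fst z) * v (snd z))"
  let ?T = "\<lambda>(x, y). (T x, T y)"
  have "distr lborel borel T \<Otimes>\<^sub>M distr lborel borel T = distr ?M (borel \<Otimes>\<^sub>M borel) ?T"
    by (rule pair_measure_distr) (auto simp: T sigma_finite_lborel)
  then have d: "distr ?M (borel \<Otimes>\<^sub>M borel) ?T = ?M" by (simp add: T)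
  have g: "?g \<in> borel_measurable (borel \<Otimes>\<^sub>M borel)" by measurable
  have m: "?T \<in> ?M \<rightarrow>\<^sub>M (borel \<Otimes>\<^sub>M borel)" by measurable
  have "energy u v = integral\<^sup>L (distr ?M (borel \<Otimes>\<^sub>M borel) ?T) ?g"
    unfolding d energy_def ..
  also have "\<dots> = (LINT z|?M. ?g (?T z))" by (rule integral_distr[OF m g])
  also have "\<dots> = energy (\<lambda>x. u (T x)) (\<lambda>x. v (T x))"
    unfolding energy_def by (simp add: case_prod_beta logk_def iso)
  finally show ?thesis by simp
qed

text \<open>Reflection in the line \<open>x \<bullet> n = t\<close>, for a unit vector \<open>n\<close>.\<close>

definition mirror :: "real^2 \<Rightarrow> real \<Rightarrow> real^2 \<Rightarrow> real^2" where
  "mirror n t x = x - (2 * (x \<bullet> n - t)) *\<^sub>R n"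

definition side :: "real^2 \<Rightarrow> real \<Rightarrow> real^2 \<Rightarrow> real" where
  "side n t x = sgn (x \<bullet> n - t)"

text \<open>The half-plane \<open>t \<le> x \<bullet> n\<close> receives the larger of the two values at mirror points. On the line itself
both values coincide.\<close>

definition polarize :: "real^2 \<Rightarrow> real \<Rightarrow> (real^2 \<Rightarrow> real) \<Rightarrow> real^2 \<Rightarrow> real" where
  "polarize n t f x = (if t \<le> x \<bullet> n then max (f x) (f (mirror n t x)) else min (f x) (f (mirror n t x)))"

lemma mirror_on_line: "x \<bullet> n = t \<Longrightarrow> mirror n t x = x"
  by (simp add: mirror_def)

lemma continuous_on_mirror [continuous_intros]:
  "continuous_on A f \<Longrightarrow> continuous_on A (\<lambda>x. mirror n t (f x))"
  unfolding mirror_def by (intro continuous_intros)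

lemma mirror_measurable [measurable]: "mirror n t \<in> borel_measurable borel"
  by (intro borel_measurable_continuous_onI continuous_on_mirror continuous_on_id)

lemma side_measurable [measurable]: "side n t \<in> borel_measurable borel"
  unfolding side_def by measurable

context
  fixes n :: "real^2" and t :: real
  assumes n: "norm n = 1"
begin

lemma nn1: "n \<bullet> n = 1"
  using n by (simp add: norm_eq_1)

lemma mirror_inner: "mirror n t x \<bullet> n - t = - (x \<bullet> n - t)"
  using nn1 by (simp add: mirror_def inner_diff_left inner_scaleR_left)

lemma mirror_mirror [simp]: "mirror n t (mirror n t x) = x"
proof -
  have "mirror n t (mirror n t x) = mirror n t x - (2 * (mirror n t x \<bullet> n - t)) *\<^sub>R n"
    by (simp add: mirror_def)
  also have "\<dots> = mirror n t x + (2 * (x \<bullet> n - t)) *\<^sub>R n"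
    unfolding mirror_inner by (simp only: mult_minus_right scaleR_minus_left diff_minus_eq_add)
  finally show ?thesis by (simp add: mirror_def)
qed

lemma side_mirror: "side n t (mirror n t x) = - side n t x"
  unfolding side_def mirror_inner sgn_minus ..

text \<open>Two points on the same side of the line are closer to each other than to each other's mirror images;
for points on different sides it is the other way round.\<close>

lemma norm_diff_mirror: "(norm (x - mirror n t y))\<^sup>2 = (norm (x - y))\<^sup>2 + 4 * ((x \<bullet> n - t) * (y \<bullet> n - t))"
proof -
  define c where "c = 2 * (y \<bullet> n - t)"
  have eq: "x - mirror n t y = (x - y) + c *\<^sub>R n" by (simp add: mirror_def c_def)
  have "(norm (x - mirror n t y))\<^sup>2 = (norm (x - y))\<^sup>2 + 2 * c * ((x - y) \<bullet> n) + c\<^sup>2"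
    unfolding eq power2_norm_eq_inner inner_add_left inner_add_right inner_scaleR_left inner_scaleR_right nn1
    by (simp add: inner_commute power2_eq_square distrib_left)
  then show ?thesis
    by (simp add: inner_diff_left c_def power2_eq_square algebra_simps)
qed

lemma norm_mirror_diff_mirror: "norm (mirror n t x - mirror n t y) = norm (x - y)"
proof -
  have "(norm (mirror n t x - mirror n t y))\<^sup>2 = (norm (mirror n t x - y))\<^sup>2 - 4 * ((x \<bullet> n - t) * (y \<bullet> n - t))"
    unfolding norm_diff_mirror mirror_inner by (simp add: algebra_simps)
  also have "norm (mirror n t x - y) = norm (y - mirror n t x)" by (rule norm_minus_commute)
  also have "(norm (y - mirror n t x))\<^sup>2 = (norm (x - y))\<^sup>2 + 4 * ((x \<bullet> n - t) * (y \<bullet> n - t))"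
    unfolding norm_diff_mirror by (simp add: norm_minus_commute mult.commute)
  finally show ?thesis by simp
qed

lemma norm_le_norm_mirror: "norm x \<le> norm (mirror n t x) + 2 * \<bar>t\<bar>"
proof -
  have "norm (x - mirror n t 0) = norm (mirror n t x)"
    using norm_mirror_diff_mirror[of x "mirror n t 0"] by simp
  moreover have "norm (mirror n t 0) = 2 * \<bar>t\<bar>" using n by (simp add: mirror_def)
  moreover have "norm x \<le> norm (mirror n t 0) + norm (x - mirror n t 0)" by (rule norm_triangle_sub)
  ultimately show ?thesis by linarith
qed

text \<open>A reflection is an orthogonal map followed by a translation.\<close>

lemma distr_mirror: "distr lborel borel (mirror n t) = lborel"
proof (rule lborel_eqI[symmetric])
  fix l u :: "real^2" assume lu: "\<And>b. b \<in> Basis \<Longrightarrow> l \<bullet> b \<le> u \<bullet> b"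
  define f where "f x = x - (2 * (x \<bullet> n)) *\<^sub>R n" for x
  have f_lin: "linear f"
    by (rule linearI) (auto simp: f_def inner_add_left inner_scaleR_left algebra_simps)
  have "norm (f x) = norm x" for x
  proof -
    have "(norm (f x))\<^sup>2 = (norm x)\<^sup>2"
      using nn1 by (simp add: f_def power2_norm_eq_inner inner_diff_left inner_diff_right inner_commute algebra_simps)
    then show ?thesis by simp
  qed
  then have f_orth: "orthogonal_transformation f"
    using f_lin by (simp add: orthogonal_transformation)
  have eq: "mirror n t x = (2 * t) *\<^sub>R n + f x" for x
    by (simp add: mirror_def f_def algebra_simps)
  have pre: "mirror n t -` box l u = (\<lambda>x. (2 * t) *\<^sub>R n + x) ` (f ` box l u)"
  proof -
    have "mirror n t -` box l u = mirror n t ` box l u"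
    proof (intro set_eqI iffI)
      fix x assume "x \<in> mirror n t -` box l u"
      then have "mirror n t (mirror n t x) \<in> mirror n t ` box l u" by (intro imageI) simp
      then show "x \<in> mirror n t ` box l u" by simp
    qed auto
    then show ?thesis by (simp add: image_image eq)
  qed
  have box: "box l u \<in> lmeasurable" by simp
  have fm: "f ` box l u \<in> lmeasurable" by (rule measurable_orthogonal_image[OF f_orth box])
  have "emeasure (distr lborel borel (mirror n t)) (box l u) = emeasure lborel (mirror n t -` box l u)"
    by (subst emeasure_distr) auto
  also have "\<dots> = emeasure lebesgue (mirror n t -` box l u)"
    using measurable_sets[OF mirror_measurable, of "box l u" n t] by (subst emeasure_completion) auto
  also have "\<dots> = ennreal (measure lebesgue (mirror n t -` box l u))"
    unfolding pre using measurable_translation[OF fm]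
    by (intro emeasure_eq_measure2) auto
  also have "measure lebesgue (mirror n t -` box l u) = measure lebesgue (box l u)"
    unfolding pre measure_translation by (rule measure_orthogonal_image[OF f_orth box])
  also have "\<dots> = (\<Prod>b\<in>Basis. (u - l) \<bullet> b)"
    using lu by (simp add: measure_completion)
  finally show "emeasure (distr lborel borel (mirror n t)) (box l u) = (\<Prod>b\<in>Basis. (u - l) \<bullet> b)" .
qed simp


lemma integral_mirror:
  fixes f :: "real^2 \<Rightarrow> real"
  assumes "f \<in> borel_measurable borel"
  shows "(LINT x|lborel. f (mirror n t x)) = integral\<^sup>L lborel f"
  using integral_distr[of "mirror n t" lborel borel f] assms
  by (simp add: distr_mirror)

lemma integrable_mirror:
  fixes f :: "real^2 \<Rightarrow> real"
  assumes "f \<in> borel_measurable borel" "integrable lborel f"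
  shows "integrable lborel (\<lambda>x. f (mirror n t x))"
  using integrable_distr_eq[of "mirror n t" lborel borel f] assms
  by (simp add: distr_mirror)

lemma nn_integral_mirror:
  fixes f :: "real^2 \<Rightarrow> ennreal"
  assumes "f \<in> borel_measurable borel"
  shows "(\<integral>\<^sup>+x. f (mirror n t x) \<partial>lborel) = integral\<^sup>N lborel f"
  using nn_integral_distr[of "mirror n t" lborel borel f] assms
  by (simp add: distr_mirror)

lemma distr_pair_mirror_snd:
  "distr (lborel \<Otimes>\<^sub>M lborel) (borel \<Otimes>\<^sub>M borel) (\<lambda>(x, y). (x, mirror n t y))
    = (lborel :: (real^2) measure) \<Otimes>\<^sub>M (lborel :: (real^2) measure)"
proof -
  have *: "distr lborel borel (\<lambda>x::real^2. x) \<Otimes>\<^sub>M distr lborel borel (mirror n t)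
      = distr (lborel \<Otimes>\<^sub>M lborel) (borel \<Otimes>\<^sub>M borel) (\<lambda>(x, y). (x, mirror n t y))"
    by (rule pair_measure_distr) (auto simp: distr_mirror sigma_finite_lborel)
  have d: "distr lborel borel (\<lambda>x::real^2. x) = (lborel :: (real^2) measure)"
    using distr_id2[of borel "lborel :: (real^2) measure"] by simp
  show ?thesis using * unfolding d distr_mirror by (rule sym)
qed

lemma energy_mirror:
  assumes "u \<in> borel_measurable borel" "v \<in> borel_measurable borel"
  shows "energy (\<lambda>x. u (mirror n t x)) (\<lambda>x. v (mirror n t x)) = energy u v"
  by (rule energy_isometry[OF mirror_measurable distr_mirror norm_mirror_diff_mirror assms])

text \<open>Reflecting both variables changes the sign of the integrand.\<close>

lemma energy_even_odd:
  assumes "e \<in> borel_measurable borel" "q \<in> borel_measurable borel"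
    and even: "\<And>x. e (mirror n t x) = e x" and odd: "\<And>x. q (mirror n t x) = - q x"
  shows "energy e q = 0"
proof -
  have "energy e q = energy e (\<lambda>x. - q x)"
    using energy_mirror[OF assms(1,2)] unfolding even odd by simp
  also have "\<dots> = - energy e q" unfolding energy_def by simp
  finally show ?thesis by simp
qed

text \<open>The kernel that the energy of an odd function sees: the contributions of \<open>y\<close> and of its mirror image
enter with opposite signs.\<close>

definition mirror_kernel :: "real^2 \<Rightarrow> real^2 \<Rightarrow> real" where
  "mirror_kernel x y = logk x y - logk x (mirror n t y)"

lemma energy_odd:
  assumes R: "0 \<le> R" and q: "q \<in> L2on (cball 0 R)" and odd: "\<And>x. q (mirror n t x) = - q x"
  shows "integrable (lborel \<Otimes>\<^sub>M lborel) (\<lambda>z. mirror_kernel (fst z) (snd z) * (q (fst z) * q (snd z)))"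
    and "2 * energy q q = (LINT z|(lborel \<Otimes>\<^sub>M lborel). mirror_kernel (fst z) (snd z) * (q (fst z) * q (snd z)))"
proof -
  note [measurable] = L2onD(1)[OF q]
  let ?M = "lborel \<Otimes>\<^sub>M (lborel :: (real^2) measure)"
  let ?g = "\<lambda>z. logk (fst z) (snd z) * (q (fst z) * q (snd z))"
  let ?g' = "\<lambda>z. logk (fst z) (mirror n t (snd z)) * (q (fst z) * q (snd z))"
  let ?m = "\<lambda>(x, y). (x, mirror n t y)"
  have g: "?g \<in> borel_measurable (borel \<Otimes>\<^sub>M borel)" by measurable
  have m: "?m \<in> ?M \<rightarrow>\<^sub>M (borel \<Otimes>\<^sub>M borel)" by measurable
  have gm: "?g (?m z) = - ?g' z" for z by (simp add: case_prod_beta odd)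
  have gi: "integrable ?M ?g" by (rule energy_integrable[OF R q q])
  then have "integrable (distr ?M (borel \<Otimes>\<^sub>M borel) ?m) ?g" by (simp only: distr_pair_mirror_snd)
  then have "integrable ?M (\<lambda>z. ?g (?m z))" unfolding integrable_distr_eq[OF m g] .
  then have "integrable ?M (\<lambda>z. - ?g' z)" unfolding gm .
  then have gi': "integrable ?M ?g'"
    using Bochner_Integration.integrable_minus[of ?M "\<lambda>z. - ?g' z"] by simp
  have "energy q q = integral\<^sup>L (distr ?M (borel \<Otimes>\<^sub>M borel) ?m) ?g"
    unfolding distr_pair_mirror_snd energy_def ..
  also have "\<dots> = (LINT z|?M. ?g (?m z))" by (rule integral_distr[OF m g])
  also have "\<dots> = (LINT z|?M. - ?g' z)" unfolding gm ..
  also have "\<dots> = - integral\<^sup>L ?M ?g'" by simp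
  finally have E: "energy q q = - integral\<^sup>L ?M ?g'" .
  have split: "mirror_kernel (fst z) (snd z) * (q (fst z) * q (snd z)) = ?g z - ?g' z" for z
    by (simp add: mirror_kernel_def algebra_simps)
  show "integrable ?M (\<lambda>z. mirror_kernel (fst z) (snd z) * (q (fst z) * q (snd z)))"
    unfolding split using gi gi' by (rule Bochner_Integration.integrable_diff)
  have "integral\<^sup>L ?M (\<lambda>z. mirror_kernel (fst z) (snd z) * (q (fst z) * q (snd z))) = integral\<^sup>L ?M ?g - integral\<^sup>L ?M ?g'"
    unfolding split using gi gi' by (rule Bochner_Integration.integral_diff)
  also have "\<dots> = 2 * energy q q" using E unfolding energy_def by linarith
  finally show "2 * energy q q = integral\<^sup>L ?M (\<lambda>z. mirror_kernel (fst z) (snd z) * (q (fst z) * q (snd z)))" by simp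
qed

text \<open>This is where strict monotonicity of the logarithm enters. The exceptional pairs are those at which
\<open>ln 0 = 0\<close> would replace the infinite value of the kernel.\<close>

lemma mirror_kernel_sign:
  assumes "x \<noteq> y" "x \<noteq> mirror n t y" "side n t x * side n t y \<noteq> 0"
  shows "0 < mirror_kernel x y * (side n t x * side n t y)"
proof -
  define p where "p = (x \<bullet> n - t) * (y \<bullet> n - t)"
  have s: "side n t x * side n t y = sgn p" by (simp add: side_def p_def sgn_mult)
  have pos: "0 < norm (x - y)" "0 < norm (x - mirror n t y)" using assms(1,2) by auto
  have sq: "(norm (x - mirror n t y))\<^sup>2 = (norm (x - y))\<^sup>2 + 4 * p"
    unfolding p_def by (rule norm_diff_mirror)
  have k: "mirror_kernel x y = ln (norm (x - mirror n t y)) - ln (norm (x - y))"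
    by (simp add: mirror_kernel_def logk_eq)
  consider "0 < p" | "p < 0" using assms(3) s by (auto simp: sgn_if split: if_splits)
  then show ?thesis
  proof cases
    case 1
    then have "(norm (x - y))\<^sup>2 < (norm (x - mirror n t y))\<^sup>2" using sq by simp
    then have "norm (x - y) < norm (x - mirror n t y)" by (rule power2_less_imp_less) simp
    then have "0 < mirror_kernel x y" unfolding k using pos by simp
    then show ?thesis using 1 s by simp
  next
    case 2
    then have "(norm (x - mirror n t y))\<^sup>2 < (norm (x - y))\<^sup>2" using sq by simp
    then have "norm (x - mirror n t y) < norm (x - y)" by (rule power2_less_imp_less) simp
    then have "mirror_kernel x y < 0" unfolding k using pos by simp
    then show ?thesis using 2 s by simp
  qed
qed

lemma AE_pair_off_diagonals:
  "AE z in lborel \<Otimes>\<^sub>M (lborel :: (real^2) measure). fst z \<noteq> snd z \<and> fst z \<noteq> mirror n t (snd z)"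
proof (rule lborel_pair.AE_pair_measure)
  show "{z \<in> space (lborel \<Otimes>\<^sub>M lborel). fst z \<noteq> snd z \<and> fst z \<noteq> mirror n t (snd z)}
      \<in> sets (lborel \<Otimes>\<^sub>M (lborel :: (real^2) measure))"
    by measurable
  show "AE x in lborel. AE y in lborel. fst (x, y) \<noteq> snd (x, y) \<and> fst (x, y) \<noteq> mirror n t (snd (x, y))"
  proof (rule AE_I2)
    fix x :: "real^2"
    show "AE y in lborel. fst (x, y) \<noteq> snd (x, y) \<and> fst (x, y) \<noteq> mirror n t (snd (x, y))"
      using AE_lborel_singleton[of x] AE_lborel_singleton[of "mirror n t x"]
      by eventually_elim auto
  qed
qed

lemma L2on_mirror:
  assumes u: "u \<in> L2on (cball 0 R)"
  shows "(\<lambda>x. u (mirror n t x)) \<in> L2on (cball 0 (R + 2 * \<bar>t\<bar>))"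
proof -
  note [measurable] = L2onD(1)[OF u]
  have "integrable lborel (\<lambda>x. (u (mirror n t x))\<^sup>2)"
    by (rule integrable_mirror[where f = "\<lambda>x. (u x)\<^sup>2"]) (use L2onD(2)[OF u] in auto)
  moreover have "u (mirror n t x) = 0" if "x \<notin> cball 0 (R + 2 * \<bar>t\<bar>)" for x
  proof -
    have "mirror n t x \<notin> cball 0 R" using that norm_le_norm_mirror[of x] by auto
    then show ?thesis by (rule L2onD(3)[OF u])
  qed
  ultimately show ?thesis unfolding L2on_def by auto
qed

text \<open>Polarization keeps the even part of \<open>f\<close> and replaces its odd part \<open>q\<close> by \<open>side * \<bar>q\<bar>\<close>.\<close>

lemma polarize_eq_even_odd:
  "polarize n t f x = (f x + f (mirror n t x)) / 2 + side n t x * \<bar>(f x - f (mirror n t x)) / 2\<bar>"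
proof (cases "x \<bullet> n = t")
  case True
  then show ?thesis by (simp add: polarize_def side_def mirror_on_line)
next
  case False
  then show ?thesis by (auto simp: polarize_def side_def max_def min_def abs_if field_simps)
qed

lemma polarize_measurable:
  assumes [measurable]: "f \<in> borel_measurable borel"
  shows "polarize n t f \<in> borel_measurable borel"
  unfolding polarize_eq_even_odd[abs_def] by measurable

text \<open>Split \<open>f = e + q\<close> into its even and odd part for the reflection; then the polarization is \<open>e + h\<close>
with \<open>h = side * \<bar>q\<bar>\<close>. The mixed energies vanish, so the gain is \<open>E(h, h) - E(q, q)\<close>, and twice this
is the double integral of \<open>mirror_kernel x y\<close> times \<open>h(x) h(y) - q(x) q(y)\<close>. The first factor has
the sign of \<open>side x * side y\<close>, and the second one has the same sign or vanishes. If the integral vanishes, so does the integrand almost everywhere,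
and \<open>side * q\<close> cannot be positive and negative on sets of positive measure.\<close>

lemma energy_polarize:
  assumes R: "0 \<le> R" and f: "f \<in> L2on (cball 0 R)"
  shows energy_le_energy_polarize: "energy f f \<le> energy (polarize n t f) (polarize n t f)"
    and energy_polarize_equality: "energy (polarize n t f) (polarize n t f) = energy f f \<Longrightarrow>
      (AE x in lborel. 0 \<le> side n t x * (f x - f (mirror n t x))) \<or>
      (AE x in lborel. side n t x * (f x - f (mirror n t x)) \<le> 0)"
proof -
  \<comment> \<open>A disc that contains the support of \<open>f\<close> and its mirror image.\<close>
  define R' where "R' = R + 2 * \<bar>t\<bar>"
  have R': "0 \<le> R'" using R by (simp add: R'_def)
  have f': "f \<in> L2on (cball 0 R')" by (rule L2on_mono[OF _ f]) (auto simp: R'_def)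
  note fm = L2on_mirror[OF f, folded R'_def]
  define e where "e = (\<lambda>x. 1 / 2 * f x + 1 / 2 * f (mirror n t x))"
  define q where "q = (\<lambda>x. 1 / 2 * f x + (- 1 / 2) * f (mirror n t x))"
  define h where "h = (\<lambda>x. side n t x * \<bar>q x\<bar>)"
  have e: "e \<in> L2on (cball 0 R')" unfolding e_def by (rule L2on_scale_add[OF f' fm])
  have q: "q \<in> L2on (cball 0 R')" unfolding q_def by (rule L2on_scale_add[OF f' fm])
  note [measurable] = L2onD(1)[OF f] L2onD(1)[OF e] L2onD(1)[OF q]
  have hm [measurable]: "h \<in> borel_measurable borel" unfolding h_def by measurable
  have side_sq: "\<bar>side n t x\<bar> \<le> 1" for x by (simp add: side_def sgn_if)
  have h_le: "(h x)\<^sup>2 \<le> (q x)\<^sup>2" for x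
  proof -
    have "\<bar>h x\<bar> \<le> 1 * \<bar>q x\<bar>" unfolding h_def abs_mult
      using side_sq[of x] by (intro mult_mono) auto
    then show ?thesis by (simp add: abs_le_square_iff)
  qed
  have h: "h \<in> L2on (cball 0 R')"
  proof -
    have "integrable lborel (\<lambda>x. (h x)\<^sup>2)"
      by (rule Bochner_Integration.integrable_bound[OF L2onD(2)[OF q]]) (use h_le in auto)
    then show ?thesis using L2onD(3)[OF q] by (auto simp: L2on_def h_def)
  qed
  have even: "e (mirror n t x) = e x" for x by (simp add: e_def)
  have oddq: "q (mirror n t x) = - q x" for x by (simp add: q_def)
  have oddh: "h (mirror n t x) = - h x" for x by (simp add: h_def oddq side_mirror)
  have f_eq: "f = (\<lambda>x. 1 * e x + 1 * q x)" by (auto simp: e_def q_def field_simps)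
  have pol_eq: "polarize n t f = (\<lambda>x. 1 * e x + 1 * h x)"
    unfolding polarize_eq_even_odd[abs_def] h_def e_def q_def by (auto simp: field_simps fun_eq_iff)
  have Ef: "energy f f = energy e e + energy q q"
    using energy_quadratic[OF R' e q, of 1 1] energy_even_odd[OF L2onD(1)[OF e] L2onD(1)[OF q] even oddq]
    unfolding f_eq[symmetric] by simp
  have Ep: "energy (polarize n t f) (polarize n t f) = energy e e + energy h h"
    using energy_quadratic[OF R' e h, of 1 1] energy_even_odd[OF L2onD(1)[OF e] hm even oddh]
    unfolding pol_eq[symmetric] by simp
  let ?M = "lborel \<Otimes>\<^sub>M (lborel :: (real^2) measure)"
  define G where "G z = mirror_kernel (fst z) (snd z) * (h (fst z) * h (snd z)) - mirror_kernel (fst z) (snd z) * (q (fst z) * q (snd z))" for z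
  note ih = energy_odd[OF R' h oddh] and iq = energy_odd[OF R' q oddq]
  have G_int: "integrable ?M G"
    unfolding G_def using ih(1) iq(1) by (rule Bochner_Integration.integrable_diff)
  have G_val: "2 * (energy (polarize n t f) (polarize n t f) - energy f f) = integral\<^sup>L ?M G"
    unfolding G_def Ef Ep using ih iq by (simp add: algebra_simps)
  have q_line: "q x = 0" if "side n t x = 0" for x
    using that by (simp add: side_def sgn_zero_iff q_def mirror_on_line)
  have G_form: "G z = (mirror_kernel (fst z) (snd z) * (side n t (fst z) * side n t (snd z)))
      * (\<bar>q (fst z) * q (snd z)\<bar> - (side n t (fst z) * q (fst z)) * (side n t (snd z) * q (snd z)))"
    if "side n t (fst z) * side n t (snd z) \<noteq> 0" for z
  proof -
    have "(side n t x) * (side n t x) = 1" if "side n t x \<noteq> 0" for x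
      using that by (auto simp: side_def sgn_if split: if_splits)
    with that have *: "side n t (fst z) * side n t (fst z) = 1" "side n t (snd z) * side n t (snd z) = 1"
      by auto
    have "mirror_kernel (fst z) (snd z) * (q (fst z) * q (snd z))
        = mirror_kernel (fst z) (snd z) * ((side n t (fst z) * side n t (fst z))
          * (side n t (snd z) * side n t (snd z)) * (q (fst z) * q (snd z)))"
      by (simp only: * mult_1)
    then show ?thesis
      unfolding G_def h_def by (simp only: abs_mult) (simp only: algebra_simps)
  qed
  have sgn_le: "(side n t x * q x) * (side n t y * q y) \<le> \<bar>q x * q y\<bar>" for x y
  proof -
    have "\<bar>(side n t x * q x) * (side n t y * q y)\<bar> = (\<bar>side n t x\<bar> * \<bar>side n t y\<bar>) * \<bar>q x * q y\<bar>"
      by (simp add: abs_mult)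
    also have "\<dots> \<le> 1 * \<bar>q x * q y\<bar>"
      using side_sq mult_le_one[OF side_sq _ side_sq] by (intro mult_right_mono) auto
    finally show ?thesis by linarith
  qed
  have G_nonneg: "AE z in ?M. 0 \<le> G z"
    using AE_pair_off_diagonals
  proof eventually_elim
    case (elim z)
    show ?case
    proof (cases "side n t (fst z) * side n t (snd z) = 0")
      case True
      then have z: "q (fst z) * q (snd z) = 0" "h (fst z) * h (snd z) = 0"
        using q_line by (auto simp: h_def)
      show ?thesis unfolding G_def z by simp
    next
      case False
      have pos: "0 < mirror_kernel (fst z) (snd z) * (side n t (fst z) * side n t (snd z))"
        using mirror_kernel_sign elim False by blast
      show ?thesis unfolding G_form[OF False]
        by (rule mult_nonneg_nonneg[OF less_imp_le[OF pos]]) (use sgn_le[of "fst z" "snd z"] in simp)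
    qed
  qed
  have "0 \<le> 2 * (energy (polarize n t f) (polarize n t f) - energy f f)"
    unfolding G_val by (rule integral_nonneg_AE[OF G_nonneg])
  then show "energy f f \<le> energy (polarize n t f) (polarize n t f)" by simp
  assume "energy (polarize n t f) (polarize n t f) = energy f f"
  then have "integral\<^sup>L ?M G = 0" using G_val by simp
  then have G0: "AE z in ?M. G z = 0"
    using integral_nonneg_eq_0_iff_AE[OF G_int G_nonneg] by simp
  have "AE z in ?M. \<not> (0 < side n t (fst z) * q (fst z) \<and> side n t (snd z) * q (snd z) < 0)"
    using G0 AE_pair_off_diagonals
  proof eventually_elim
    case (elim z)
    show ?case
    proof
      assume s: "0 < side n t (fst z) * q (fst z) \<and> side n t (snd z) * q (snd z) < 0"
      then have nz: "side n t (fst z) * side n t (snd z) \<noteq> 0" by auto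
      have "(side n t (fst z) * q (fst z)) * (side n t (snd z) * q (snd z)) < 0"
        using s by (simp add: mult_pos_neg)
      then have "0 < \<bar>q (fst z) * q (snd z)\<bar> - (side n t (fst z) * q (fst z)) * (side n t (snd z) * q (snd z))"
        by linarith
      moreover have "0 < mirror_kernel (fst z) (snd z) * (side n t (fst z) * side n t (snd z))"
        using mirror_kernel_sign elim nz by blast
      ultimately have "0 < G z" unfolding G_form[OF nz] by (rule mult_pos_pos[rotated])
      then show False using elim by simp
    qed
  qed
  from lborel_pair.AE_pair[OF this]
  have ae: "AE x in lborel. AE y in lborel. \<not> (0 < side n t x * q x \<and> side n t y * q y < 0)" by simp
  have qf: "side n t x * (f x - f (mirror n t x)) = 2 * (side n t x * q x)" for x
    by (simp add: q_def field_simps)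
  show "(AE x in lborel. 0 \<le> side n t x * (f x - f (mirror n t x))) \<or>
      (AE x in lborel. side n t x * (f x - f (mirror n t x)) \<le> 0)"
  proof (cases "AE y in lborel. \<not> side n t y * q y < 0")
    case True
    then have "AE x in lborel. 0 \<le> side n t x * (f x - f (mirror n t x))"
      unfolding qf not_less by eventually_elim (rule mult_nonneg_nonneg, simp)
    then show ?thesis ..
  next
    case False
    from ae have "AE x in lborel. \<not> 0 < side n t x * q x"
    proof eventually_elim
      case (elim x)
      show ?case using elim False by auto
    qed
    then have "AE x in lborel. side n t x * (f x - f (mirror n t x)) \<le> 0"
      unfolding qf not_less by eventually_elim (rule mult_nonneg_nonpos, simp)
    then show ?thesis ..
  qed
qed

text \<open>At each pair of mirror points the polarization has the same two values as \<open>f\<close>, so both integrals are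
half the integral of the same symmetrized function.\<close>

lemma nn_integral_polarize:
  fixes \<phi> :: "real \<Rightarrow> ennreal"
  assumes [measurable]: "f \<in> borel_measurable borel" "\<phi> \<in> borel_measurable borel"
  shows "(\<integral>\<^sup>+x. \<phi> (polarize n t f x) \<partial>lborel) = (\<integral>\<^sup>+x. \<phi> (f x) \<partial>lborel)"
proof -
  note [measurable] = polarize_measurable[OF assms(1)]
  have pt: "\<phi> (polarize n t f x) + \<phi> (polarize n t f (mirror n t x)) = \<phi> (f x) + \<phi> (f (mirror n t x))" for x
  proof -
    have "mirror n t x \<bullet> n - t = - (x \<bullet> n - t)" by (rule mirror_inner)
    then consider "t < x \<bullet> n" "mirror n t x \<bullet> n < t" | "x \<bullet> n = t" | "x \<bullet> n < t" "t < mirror n t x \<bullet> n" by linarith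
    then show ?thesis
      by cases (auto simp: polarize_def mirror_on_line max_def min_def add.commute)
  qed
  have dbl: "2 * (\<integral>\<^sup>+x. \<phi> (g x) \<partial>lborel) = (\<integral>\<^sup>+x. \<phi> (g x) + \<phi> (g (mirror n t x)) \<partial>lborel)"
    if [measurable]: "g \<in> borel_measurable borel" for g
  proof -
    have "(\<integral>\<^sup>+x. \<phi> (g (mirror n t x)) \<partial>lborel) = (\<integral>\<^sup>+x. \<phi> (g x) \<partial>lborel)"
      by (rule nn_integral_mirror[where f = "\<lambda>x. \<phi> (g x)"]) measurable
    then show ?thesis by (subst nn_integral_add) (auto simp: mult_2)
  qed
  have "2 * (\<integral>\<^sup>+x. \<phi> (polarize n t f x) \<partial>lborel) = 2 * (\<integral>\<^sup>+x. \<phi> (f x) \<partial>lborel)"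
    by (subst (1 2) dbl) (auto simp: pt)
  then show ?thesis by (simp add: ennreal_mult_cancel_left)
qed

end

section \<open>Open sets that are one-sided for every line\<close>

lemma mirror_neg: "mirror (- n) (- t) x = mirror n t x"
proof -
  have "x \<bullet> (- n) - (- t) = - (x \<bullet> n - t)" by simp
  then show ?thesis unfolding mirror_def
    by (simp only: mult_minus_right scaleR_minus_left scaleR_minus_right minus_minus)
qed

lemma side_neg: "side (- n) (- t) x = - side n t x"
proof -
  have "x \<bullet> (- n) - (- t) = - (x \<bullet> n - t)" by simp
  then show ?thesis unfolding side_def by (simp only: sgn_minus)
qed

text \<open>For each line, \<open>f\<close> dominates its mirror image almost everywhere on one of the two sides; which side it
is may depend on the line.\<close>

definition one_sided :: "(real^2 \<Rightarrow> real) \<Rightarrow> bool" where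
  "one_sided f \<longleftrightarrow> (\<forall>n t. norm n = 1 \<longrightarrow>
    (AE x in lborel. 0 \<le> side n t x * (f x - f (mirror n t x))) \<or>
    (AE x in lborel. side n t x * (f x - f (mirror n t x)) \<le> 0))"

lemma one_sided_support:
  assumes f: "one_sided f" and nonneg: "\<And>x. 0 \<le> f x"
  shows "one_sided (indicator {x. 0 < f x})"
  unfolding one_sided_def
proof (intro allI impI)
  fix n :: "real^2" and t :: real assume n: "norm n = 1"
  let ?i = "indicator {x. 0 < f x} :: real^2 \<Rightarrow> real"
  have imp: "0 \<le> s * (f x - f y) \<Longrightarrow> 0 \<le> s * (?i x - ?i y)"
    "s * (f x - f y) \<le> 0 \<Longrightarrow> s * (?i x - ?i y) \<le> 0" for s x y
    using nonneg[of x] nonneg[of y]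
    by (auto simp: indicator_def zero_le_mult_iff mult_le_0_iff not_less)
  from f n have "(AE x in lborel. 0 \<le> side n t x * (f x - f (mirror n t x))) \<or>
    (AE x in lborel. side n t x * (f x - f (mirror n t x)) \<le> 0)"
    unfolding one_sided_def by blast
  then show "(AE x in lborel. 0 \<le> side n t x * (?i x - ?i (mirror n t x))) \<or>
    (AE x in lborel. side n t x * (?i x - ?i (mirror n t x)) \<le> 0)"
  proof
    assume "AE x in lborel. 0 \<le> side n t x * (f x - f (mirror n t x))"
    then have "AE x in lborel. 0 \<le> side n t x * (?i x - ?i (mirror n t x))"
      by eventually_elim (rule imp)
    then show ?thesis ..
  next
    assume "AE x in lborel. side n t x * (f x - f (mirror n t x)) \<le> 0"
    then have "AE x in lborel. side n t x * (?i x - ?i (mirror n t x)) \<le> 0"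
      by eventually_elim (rule imp)
    then show ?thesis ..
  qed
qed

text \<open>Let \<open>a\<close> be the centroid of \<open>U\<close>. Integrating the signed distance to a line over \<open>U\<close> shows that the
side of the line that contains \<open>a\<close> must be the dominating one. If \<open>x\<^sub>0 \<in> U\<close> and \<open>y\<^sub>0\<close> is closer to
\<open>a\<close> than \<open>x\<^sub>0\<close>, take the line that mirrors \<open>x\<^sub>0\<close> to \<open>y\<^sub>0\<close>: the point \<open>a\<close> lies on the side of \<open>y\<^sub>0\<close>, so a
neighbourhood of \<open>y\<^sub>0\<close> is contained in \<open>U\<close> up to a null set. Hence \<open>U\<close> fills the smallest disc around
\<open>a\<close> that contains it.\<close>

theorem one_sided_open_is_ball:
  fixes U :: "(real^2) set"
  assumes U: "open U" "bounded U" "U \<noteq> {}" and os: "one_sided (indicator U)"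
  shows "\<exists>a r. 0 < r \<and> U \<subseteq> ball a r \<and> ball a r - U \<in> null_sets lborel \<and>
    emeasure lborel U = ennreal (pi * r\<^sup>2)"
proof -
  let ?i = "indicator U :: real^2 \<Rightarrow> real"
  have Ub [measurable]: "U \<in> sets borel" using U(1) by simp
  obtain R where R: "0 \<le> R" "U \<subseteq> cball 0 R" by (rule bounded_subset_cball_0[OF U(2)])
  define m where "m = measure lborel U"
  have fin: "emeasure lborel U < \<infinity>"
    using emeasure_bounded_finite[OF U(2)] by simp
  have i_int: "integrable lborel ?i" using fin by (intro integrable_real_indicator) auto
  have m_pos: "0 < m" unfolding m_def by (rule measure_open_bounded_pos[OF U])
  have ix_int: "integrable lborel (\<lambda>x. ?i x *\<^sub>R x)"
  proof (rule Bochner_Integration.integrable_bound)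
    show "integrable lborel (\<lambda>x. R * ?i x)" using i_int by simp
    show "AE x in lborel. norm (?i x *\<^sub>R x) \<le> norm (R * ?i x)"
      using R by (intro AE_I2) (auto simp: indicator_def)
  qed measurable
  define a where "a = (1 / m) *\<^sub>R (LINT x|lborel. ?i x *\<^sub>R x)"
  have centroid_int: "integrable lborel (\<lambda>x. (x \<bullet> n - t) * ?i x)"
    and centroid: "(LINT x|lborel. (x \<bullet> n - t) * ?i x) = m * (a \<bullet> n - t)" for n t
  proof -
    have eq: "(\<lambda>x. (x \<bullet> n - t) * ?i x) = (\<lambda>x. (?i x *\<^sub>R x) \<bullet> n - t * ?i x)"
      by (auto simp: algebra_simps)
    show "integrable lborel (\<lambda>x. (x \<bullet> n - t) * ?i x)"
      unfolding eq
      by (rule Bochner_Integration.integrable_diff[OF integrable_inner_left[OF ix_int] integrable_mult_right[OF i_int]])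
    have "(LINT x|lborel. (?i x *\<^sub>R x) \<bullet> n - t * ?i x)
        = (LINT x|lborel. (?i x *\<^sub>R x) \<bullet> n) - (LINT x|lborel. t * ?i x)"
      by (rule Bochner_Integration.integral_diff[OF integrable_inner_left[OF ix_int] integrable_mult_right[OF i_int]])
    also have "(LINT x|lborel. (?i x *\<^sub>R x) \<bullet> n) = (LINT x|lborel. ?i x *\<^sub>R x) \<bullet> n"
      by (rule integral_inner_left[OF ix_int])
    also have "(LINT x|lborel. t * ?i x) = t * m" by (simp add: m_def)
    also have "(LINT x|lborel. ?i x *\<^sub>R x) \<bullet> n - t * m = m * (a \<bullet> n - t)"
      using m_pos by (simp add: a_def field_simps)
    finally show "(LINT x|lborel. (x \<bullet> n - t) * ?i x) = m * (a \<bullet> n - t)" unfolding eq .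
  qed
  have dir: "AE x in lborel. 0 \<le> side n t x * (?i x - ?i (mirror n t x))"
    if n: "norm n = 1" and a: "t < a \<bullet> n" for n t
  proof (rule ccontr)
    assume "\<not> (AE x in lborel. 0 \<le> side n t x * (?i x - ?i (mirror n t x)))"
    then have neg: "AE x in lborel. side n t x * (?i x - ?i (mirror n t x)) \<le> 0"
      using os n unfolding one_sided_def by blast
    let ?g = "\<lambda>x. (mirror n t x \<bullet> n - t) * ?i x"
    have g_eq: "?g x = - ((x \<bullet> n - t) * ?i x)" for x unfolding mirror_inner[OF n] by (rule mult_minus_left)
    have gm: "?g (mirror n t x) = (x \<bullet> n - t) * ?i (mirror n t x)" for x
      by (simp add: mirror_mirror[OF n])
    have g_meas: "?g \<in> borel_measurable borel" by measurable
    have g_int: "integrable lborel ?g" unfolding g_eq using centroid_int by simp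
    have "(LINT x|lborel. (x \<bullet> n - t) * ?i x - (x \<bullet> n - t) * ?i (mirror n t x))
        = m * (a \<bullet> n - t) - (LINT x|lborel. (x \<bullet> n - t) * ?i (mirror n t x))"
      using centroid_int integrable_mirror[OF n g_meas g_int, of t] unfolding gm
      by (subst Bochner_Integration.integral_diff) (auto simp: centroid)
    also have "(LINT x|lborel. (x \<bullet> n - t) * ?i (mirror n t x)) = integral\<^sup>L lborel ?g"
      using integral_mirror[OF n g_meas, of t] unfolding gm .
    also have "integral\<^sup>L lborel ?g = - (m * (a \<bullet> n - t))"
      unfolding g_eq using centroid by simp
    finally have "(LINT x|lborel. (x \<bullet> n - t) * ?i x - (x \<bullet> n - t) * ?i (mirror n t x)) = 2 * (m * (a \<bullet> n - t))"
      by simp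
    moreover have "0 < m * (a \<bullet> n - t)" using m_pos a by simp
    moreover have "(LINT x|lborel. (x \<bullet> n - t) * ?i x - (x \<bullet> n - t) * ?i (mirror n t x)) \<le> 0"
    proof -
      have "AE x in lborel. 0 \<le> - ((x \<bullet> n - t) * ?i x - (x \<bullet> n - t) * ?i (mirror n t x))"
        using neg
      proof eventually_elim
        case (elim x)
        have "(x \<bullet> n - t) * ?i x - (x \<bullet> n - t) * ?i (mirror n t x)
            = \<bar>x \<bullet> n - t\<bar> * (side n t x * (?i x - ?i (mirror n t x)))"
          unfolding side_def by (simp add: sgn_if abs_if algebra_simps)
        also have "\<dots> \<le> 0" by (rule mult_nonneg_nonpos[OF abs_ge_zero elim])
        finally show ?case by (simp only: neg_0_le_iff_le)
      qed
      from integral_nonneg_AE[OF this] show ?thesis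
        unfolding Bochner_Integration.integral_minus by (simp only: neg_0_le_iff_le)
    qed
    ultimately show False by linarith
  qed
  \<comment> \<open>reflecting a point of \<open>U\<close> to a point nearer to the centroid\<close>
  have near: "\<exists>e>0. AE x in lborel. x \<in> ball y0 e \<longrightarrow> x \<in> U"
    if x0: "x0 \<in> U" and y0: "dist a y0 < dist a x0" for x0 y0
  proof -
    define d where "d = norm (y0 - x0)"
    have "y0 \<noteq> x0" using y0 by auto
    then have d: "0 < d" by (simp add: d_def)
    define n where "n = (1 / d) *\<^sub>R (y0 - x0)"
    \<comment> \<open>The line is the perpendicular bisector of \<open>x\<^sub>0\<close> and \<open>y\<^sub>0\<close>.\<close>
    define t where "t = ((1 / 2) *\<^sub>R (y0 + x0)) \<bullet> n"
    have n: "norm n = 1" using d by (simp add: n_def d_def)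
    have dn: "d *\<^sub>R n = y0 - x0" using d by (simp add: n_def)
    have y0t: "y0 \<bullet> n - t = d / 2"
    proof -
      have "y0 \<bullet> n - t = (1 / 2) * ((y0 - x0) \<bullet> n)"
        by (simp add: t_def inner_add_left inner_diff_left field_simps)
      also have "\<dots> = (1 / 2) * (d * (n \<bullet> n))" by (simp flip: dn)
      finally show ?thesis using nn1[OF n] by simp
    qed
    have my0: "mirror n t y0 = x0"
      unfolding mirror_def y0t using dn by simp
    have at: "t < a \<bullet> n"
    proof -
      have "(norm (a - mirror n t y0))\<^sup>2 = (norm (a - y0))\<^sup>2 + 4 * ((a \<bullet> n - t) * (y0 \<bullet> n - t))"
        by (rule norm_diff_mirror[OF n])
      moreover have "(norm (a - y0))\<^sup>2 < (norm (a - x0))\<^sup>2"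
        using y0 unfolding dist_norm by (intro power_strict_mono) auto
      ultimately have "0 < d * (a \<bullet> n - t)" unfolding my0 y0t by simp
      then show ?thesis using d by (simp add: zero_less_mult_iff)
    qed
    obtain e0 where e0: "0 < e0" "ball x0 e0 \<subseteq> U"
      using U(1) x0 open_contains_ball by blast
    define e where "e = min e0 (d / 2)"
    have "AE x in lborel. x \<in> ball y0 e \<longrightarrow> x \<in> U"
      using dir[OF n at]
    proof eventually_elim
      case (elim x)
      show ?case
      proof
        assume x: "x \<in> ball y0 e"
        then have xy: "norm (y0 - x) < e" by (simp add: dist_norm)
        have "\<bar>(y0 - x) \<bullet> n\<bar> \<le> norm (y0 - x) * norm n" by (rule Cauchy_Schwarz_ineq2)
        then have "\<bar>y0 \<bullet> n - x \<bullet> n\<bar> \<le> norm (y0 - x)" using n by (simp add: inner_diff_left)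
        moreover have "norm (y0 - x) < d / 2" using xy by (simp add: e_def)
        ultimately have "y0 \<bullet> n - x \<bullet> n < d / 2" by linarith
        then have "side n t x = 1" using y0t by (simp add: side_def)
        moreover have "mirror n t x \<in> U"
        proof -
          have "norm (mirror n t y0 - mirror n t x) < e"
            unfolding norm_mirror_diff_mirror[OF n] by (rule xy)
          then show ?thesis using e0(2) unfolding my0 by (auto simp: e_def dist_norm)
        qed
        ultimately show "x \<in> U" using elim by (cases "x \<in> U") simp_all
      qed
    qed
    then show ?thesis using e0 d by (intro exI[of _ e]) (auto simp: e_def)
  qed
  define r where "r = (SUP x\<in>U. dist a x)"
  have bdd: "bdd_above ((\<lambda>x. dist a x) ` U)"
  proof (rule bdd_aboveI2)
    fix x assume "x \<in> U"
    then show "dist a x \<le> norm a + R"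
      using R norm_triangle_ineq4[of a x] by (auto simp: dist_norm)
  qed
  have sub: "U \<subseteq> cball a r"
    unfolding r_def using cSUP_upper[OF _ bdd] by auto
  have r: "0 < r"
  proof (rule ccontr)
    assume "\<not> 0 < r"
    have "x = a" if "x \<in> U" for x
    proof -
      have "x \<in> cball a r" using sub that by blast
      then have "dist a x \<le> 0" using \<open>\<not> 0 < r\<close> unfolding mem_cball by linarith
      then show ?thesis by simp
    qed
    then have "U \<subseteq> {a}" by blast
    then have "emeasure lborel U \<le> emeasure lborel {a}" by (intro emeasure_mono) auto
    then have "emeasure lborel U = 0" by simp
    then show False using m_pos by (simp add: m_def measure_def)
  qed
  have negl: "negligible (ball a r - U)"
  proof (rule locally_negligible_alt[THEN iffD2], rule ballI)
    fix y0 assume y0: "y0 \<in> ball a r - U"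
    then have "dist a y0 < (SUP x\<in>U. dist a x)" by (simp add: r_def)
    then obtain x0 where x0: "x0 \<in> U" "dist a y0 < dist a x0"
      unfolding less_cSUP_iff[OF U(3) bdd] by blast
    from near[OF x0] obtain e where e: "0 < e" "AE x in lborel. x \<in> ball y0 e \<longrightarrow> x \<in> U"
      by blast
    have "AE x in lborel. x \<notin> ball y0 e - U" using e(2) by eventually_elim auto
    then have "ball y0 e - U \<in> null_sets lborel" by (subst AE_iff_null_sets) auto
    then have "ball y0 e - U \<in> null_sets lebesgue" by (rule null_sets_completionI)
    then have "negligible (ball y0 e - U)" by (simp add: negligible_iff_null_sets)
    then have "negligible ((ball a r - U) \<inter> ball y0 e)" by (rule negligible_subset) auto
    moreover have "openin (top_of_set (ball a r - U)) ((ball a r - U) \<inter> ball y0 e)"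
      by (simp add: openin_open_Int)
    ultimately show "\<exists>V. openin (top_of_set (ball a r - U)) V \<and> y0 \<in> V \<and> negligible V"
      using y0 e(1) by (intro exI[of _ "(ball a r - U) \<inter> ball y0 e"]) auto
  qed
  have U_ball: "U \<subseteq> ball a r"
    using interior_maximal[OF sub U(1)] by simp
  have null: "ball a r - U \<in> null_sets lborel"
  proof -
    have "ball a r - U \<in> null_sets lebesgue" using negl by (simp add: negligible_iff_null_sets)
    then have "emeasure lebesgue (ball a r - U) = 0" by auto
    then show ?thesis by (intro null_setsI) (auto simp: emeasure_completion)
  qed
  have "emeasure lborel (ball a r) = emeasure lborel U"
    using emeasure_Un_null_set[OF _ null, of U] U_ball by (simp add: Un_absorb1)
  then have "emeasure lborel U = ennreal (pi * r\<^sup>2)"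
    using emeasure_lborel_ball_plane[of r a] r by simp
  with r U_ball null show ?thesis by blast
qed

section \<open>Energy maximizers among Lipschitz functions\<close>

text \<open>The norm and the area of the support are part of the class because they are the data that have to
survive the passage to a maximizer. The area is only bounded from above, since it can drop in the
limit of a sequence.\<close>

definition lip_class :: "real \<Rightarrow> real \<Rightarrow> real \<Rightarrow> real \<Rightarrow> (real^2 \<Rightarrow> real) set" where
  "lip_class L R V s = {g. (\<forall>x y. \<bar>g x - g y\<bar> \<le> L * dist x y) \<and> (\<forall>x. 0 \<le> g x) \<and>
    (\<forall>x. x \<notin> cball 0 R \<longrightarrow> g x = 0) \<and> (LINT x|lborel. (g x)\<^sup>2) = s \<and>
    emeasure lborel {x. 0 < g x} \<le> ennreal V}"

lemma lip_classD:
  assumes "g \<in> lip_class L R V s"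
  shows "\<bar>g x - g y\<bar> \<le> L * dist x y" "0 \<le> g x" "x \<notin> cball 0 R \<Longrightarrow> g x = 0"
    "(LINT x|lborel. (g x)\<^sup>2) = s" "emeasure lborel {x. 0 < g x} \<le> ennreal V"
  using assms by (auto simp: lip_class_def)

lemma lip_class_continuous:
  assumes g: "g \<in> lip_class L R V s" and L: "0 \<le> L"
  shows "continuous_on UNIV g"
proof -
  have "L-lipschitz_on UNIV g"
    by (rule lipschitz_onI) (use lip_classD(1)[OF g] L in \<open>auto simp: dist_real_def\<close>)
  then show ?thesis by (rule lipschitz_on_continuous_on)
qed

lemma lip_class_bounded:
  assumes g: "g \<in> lip_class L R V s" and L: "0 \<le> L" and R: "0 \<le> R"
  shows "\<bar>g x\<bar> \<le> L * (2 * R + 1)"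
proof (cases "x \<in> cball 0 R")
  case True
  \<comment> \<open>The function vanishes at \<open>p\<close>, so the Lipschitz condition bounds it everywhere.\<close>
  obtain p :: "real^2" where p: "norm p = R + 1"
    using vector_choose_size[of "R + 1"] R by auto
  then have "g p = 0" using lip_classD(3)[OF g, of p] by simp
  then have "\<bar>g x\<bar> \<le> L * dist x p" using lip_classD(1)[OF g, of x p] by simp
  also have "\<dots> \<le> L * (2 * R + 1)"
    using True p norm_triangle_ineq4[of x p] L by (intro mult_left_mono) (auto simp: dist_norm)
  finally show ?thesis .
next
  case False
  then show ?thesis using lip_classD(3)[OF g False] L R by simp
qed

lemma lip_class_L2on:
  assumes g: "g \<in> lip_class L R V s" and L: "0 \<le> L" and R: "0 \<le> R"
  shows "g \<in> L2on (cball 0 R)"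
  using lip_class_bounded[OF assms] lip_classD(3)[OF g] lip_class_continuous[OF g L]
  by (intro bounded_L2on[where R = R]) (auto intro: borel_measurable_continuous_onI)

lemma integral_square_polarize:
  assumes n: "norm n = 1" and f: "f \<in> borel_measurable borel"
  shows "(LINT x|lborel. (polarize n t f x)\<^sup>2) = (LINT x|lborel. (f x)\<^sup>2)"
proof -
  have eq: "(LINT x|lborel. (g x)\<^sup>2) = enn2real (\<integral>\<^sup>+x. ennreal ((g x)\<^sup>2) \<partial>lborel)"
    if "g \<in> borel_measurable borel" for g :: "real^2 \<Rightarrow> real"
    using that by (intro integral_eq_nn_integral) auto
  show ?thesis
    unfolding eq[OF f] eq[OF polarize_measurable[OF n f]]
    using nn_integral_polarize[OF n f, of "\<lambda>y. ennreal (y\<^sup>2)"] by simp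
qed

lemma emeasure_pos_polarize:
  assumes n: "norm n = 1" and f [measurable]: "f \<in> borel_measurable borel"
  shows "emeasure lborel {x. 0 < polarize n t f x} = emeasure lborel {x. 0 < f x}"
proof -
  have eq: "emeasure lborel {x. 0 < g x} = (\<integral>\<^sup>+x. indicator {0<..} (g x) \<partial>lborel)"
    if [measurable]: "g \<in> borel_measurable borel" for g :: "real^2 \<Rightarrow> real"
  proof -
    have "(\<lambda>x. indicator {0<..} (g x) :: ennreal) = indicator {x. 0 < g x}"
      by (auto simp: indicator_def)
    then show ?thesis by simp
  qed
  show ?thesis
    unfolding eq[OF f] eq[OF polarize_measurable[OF n f]] by (rule nn_integral_polarize[OF n f]) measurable
qed

text \<open>The condition \<open>t \<le> 0\<close> says that the origin lies on the side that receives the larger values, which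
keeps the support inside the disc. For the Lipschitz bound, the distance from \<open>x\<close> to \<open>y\<close> is at least
the distance from \<open>x\<close> to the mirror image of \<open>y\<close> when \<open>x\<close> and \<open>y\<close> lie on different sides.\<close>

lemma polarize_lip_class:
  assumes n: "norm n = 1" and t: "t \<le> 0" and L: "0 \<le> L" and g: "g \<in> lip_class L R V s"
  shows "polarize n t g \<in> lip_class L R V s"
proof -
  let ?m = "mirror n t"
  note Lip = lip_classD(1)[OF g]
  have gm: "g \<in> borel_measurable borel"
    by (rule borel_measurable_continuous_onI[OF lip_class_continuous[OF g L]])
  have iso: "dist (?m x) (?m y) = dist x y" for x y
    unfolding dist_norm by (rule norm_mirror_diff_mirror[OF n])
  have cross: "dist x (?m y) \<le> dist x y" "dist (?m x) y \<le> dist x y"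
    if "t \<le> x \<bullet> n" "y \<bullet> n < t" for x y
  proof -
    have "(x \<bullet> n - t) * (y \<bullet> n - t) \<le> 0" using that by (simp add: mult_nonneg_nonpos)
    then have "(norm (x - ?m y))\<^sup>2 \<le> (norm (x - y))\<^sup>2" unfolding norm_diff_mirror[OF n] by simp
    then show *: "dist x (?m y) \<le> dist x y" unfolding dist_norm by (rule power2_le_imp_le) simp
    have "dist (?m x) y = dist x (?m y)" using iso[of x "?m y"] by (simp add: mirror_mirror[OF n])
    with * show "dist (?m x) y \<le> dist x y" by simp
  qed
  have up: "g a - g b \<le> L * D" "g b - g a \<le> L * D" if "dist a b \<le> D" for a b D
    using Lip[of a b] mult_left_mono[OF that L] by linarith+
  have ordered: "\<bar>polarize n t g x - polarize n t g y\<bar> \<le> L * dist x y" if xy: "t \<le> x \<bullet> n" "y \<bullet> n < t" for x y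
    using up[of x y "dist x y"] up[OF cross(1)[OF xy]] up[OF cross(2)[OF xy]] up[of "?m x" "?m y" "dist x y"]
      iso[of x y] xy
    by (auto simp: polarize_def abs_le_iff max_def min_def)
  have "\<bar>polarize n t g x - polarize n t g y\<bar> \<le> L * dist x y" for x y
  proof -
    consider "t \<le> x \<bullet> n" "t \<le> y \<bullet> n" | "x \<bullet> n < t" "y \<bullet> n < t"
      | "t \<le> x \<bullet> n" "y \<bullet> n < t" | "x \<bullet> n < t" "t \<le> y \<bullet> n" by linarith
    then show ?thesis
    proof cases
      case 3
      then show ?thesis by (rule ordered)
    next
      case 4
      then show ?thesis using ordered[of y x] by (simp add: dist_commute abs_minus_commute)
    qed (use up[of x y "dist x y"] up[of "?m x" "?m y" "dist x y"] iso[of x y] in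
        \<open>auto simp: polarize_def abs_le_iff max_def min_def\<close>)
  qed
  moreover have "0 \<le> polarize n t g x" for x
    using lip_classD(2)[OF g, of x] lip_classD(2)[OF g, of "?m x"] by (auto simp: polarize_def)
  moreover have "polarize n t g x = 0" if x: "x \<notin> cball 0 R" for x
  proof (cases "t \<le> x \<bullet> n")
    case True
    have "(norm (0 - ?m x))\<^sup>2 = (norm (0 - x))\<^sup>2 + 4 * ((0 \<bullet> n - t) * (x \<bullet> n - t))"
      by (rule norm_diff_mirror[OF n])
    moreover have "0 \<le> (0 \<bullet> n - t) * (x \<bullet> n - t)"
      using True t by (intro mult_nonneg_nonneg) auto
    ultimately have "(norm x)\<^sup>2 \<le> (norm (?m x))\<^sup>2" by simp
    then have "norm x \<le> norm (?m x)" by (rule power2_le_imp_le) simp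
    then have "?m x \<notin> cball 0 R" using x by simp
    then show ?thesis using True x lip_classD(3)[OF g] by (simp add: polarize_def)
  next
    case False
    have "g x = 0" using x by (rule lip_classD(3)[OF g])
    then show ?thesis using False lip_classD(2)[OF g, of "?m x"] by (simp add: polarize_def)
  qed
  moreover have "(LINT x|lborel. (polarize n t g x)\<^sup>2) = s"
    unfolding integral_square_polarize[OF n gm] by (rule lip_classD(4)[OF g])
  moreover have "emeasure lborel {x. 0 < polarize n t g x} \<le> ennreal V"
    unfolding emeasure_pos_polarize[OF n gm] by (rule lip_classD(5)[OF g])
  ultimately show ?thesis unfolding lip_class_def by blast
qed

text \<open>Arzela--Ascoli gives a uniform limit of a maximizing sequence. Norm and energy are continuous along
it, and Fatou's lemma bounds the area of the support of the limit.\<close>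

lemma exists_energy_maximizer:
  assumes L: "0 \<le> L" and R: "0 \<le> R" and ne: "lip_class L R V s \<noteq> {}"
  shows "\<exists>g\<in>lip_class L R V s. \<forall>f\<in>lip_class L R V s. energy f f \<le> energy g g"
proof -
  let ?C = "lip_class L R V s"
  define A where "A = (\<lambda>f. energy f f) ` ?C"
  define M where "M = Sup A"
  have bdd: "bdd_above A"
  proof (rule bdd_aboveI)
    fix e assume "e \<in> A"
    then obtain f where f: "f \<in> ?C" "e = energy f f" unfolding A_def by blast
    have "\<bar>energy f f\<bar> \<le> (slice_bound R * pi * R\<^sup>2 + 1) * s"
      using energy_abs_le[OF R lip_class_L2on[OF f(1) L R]] lip_classD(4)[OF f(1)] by simp
    then show "e \<le> (slice_bound R * pi * R\<^sup>2 + 1) * s" unfolding f(2) by linarith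
  qed
  have "A \<noteq> {}" using ne by (simp add: A_def)
  have "\<exists>f. f \<in> ?C \<and> M - 1 / real (Suc n) < energy f f" for n
  proof -
    have "M - 1 / real (Suc n) < Sup A" unfolding M_def by simp
    then obtain e where "e \<in> A" "M - 1 / real (Suc n) < e"
      using less_cSup_iff[OF \<open>A \<noteq> {}\<close> bdd] by blast
    then show ?thesis unfolding A_def by blast
  qed
  then obtain f where f: "\<And>n. f n \<in> ?C" and fM: "\<And>n. M - 1 / real (Suc n) < energy (f n) (f n)"
    by metis
  define B where "B = L * (2 * R + 1)"
  have B: "\<bar>f n x\<bar> \<le> B" for n x unfolding B_def by (rule lip_class_bounded[OF f L R])
  have eq: "\<bar>f n x - f n y\<bar> < e" if "0 < e" "norm (x - y) < e / (L + 1)" for n x y e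
  proof -
    have "\<bar>f n x - f n y\<bar> \<le> L * norm (x - y)" using lip_classD(1)[OF f] by (simp add: dist_norm)
    also have "\<dots> \<le> (L + 1) * norm (x - y)" by (intro mult_right_mono) auto
    also have "\<dots> < e" using that L by (simp add: field_simps)
    finally show ?thesis .
  qed
  obtain g0 k where k: "strict_mono (k :: nat \<Rightarrow> nat)"
    and conv: "\<And>e. 0 < e \<Longrightarrow> \<exists>N. \<forall>n x. n \<ge> N \<and> x \<in> cball 0 R \<longrightarrow> norm (f (k n) x - g0 x) < e"
  proof (rule Arzela_Ascoli[of "cball (0::real^2) R" f B])
    show "\<exists>d>0. \<forall>n y. y \<in> cball 0 R \<and> norm (x - y) < d \<longrightarrow> norm (f n x - f n y) < e"
      if "x \<in> cball 0 R" "0 < e" for x e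
      using eq[OF that(2)] that(2) L by (intro exI[of _ "e / (L + 1)"]) auto
  qed (use B in auto)
  define g where "g x = (if x \<in> cball 0 R then g0 x else 0)" for x
  have lim: "(\<lambda>n. f (k n) x) \<longlonglongrightarrow> g x" for x
  proof (cases "x \<in> cball 0 R")
    case True
    then have "g x = g0 x" by (simp add: g_def)
    then show ?thesis unfolding LIMSEQ_iff using conv True by metis
  next
    case False
    then have "f (k n) x = 0" for n by (rule lip_classD(3)[OF f])
    then show ?thesis using False unfolding g_def by auto
  qed
  have fm: "f n \<in> borel_measurable borel" for n
    by (rule borel_measurable_continuous_onI[OF lip_class_continuous[OF f L]])
  note fm [measurable]
  have gm [measurable]: "g \<in> borel_measurable borel"
    by (rule borel_measurable_LIMSEQ_real[OF lim fm])
  note conv = energy_bounded_convergence[OF R fm B lip_classD(3)[OF f] lim]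
  have gC: "g \<in> ?C"
    unfolding lip_class_def
  proof (intro CollectI conjI allI impI)
    show "\<bar>g x - g y\<bar> \<le> L * dist x y" for x y
      by (rule LIMSEQ_le_const2[OF tendsto_rabs[OF tendsto_diff[OF lim lim]]])
        (use lip_classD(1)[OF f] in blast)
    show "0 \<le> g x" for x
      by (rule LIMSEQ_le_const[OF lim]) (use lip_classD(2)[OF f] in blast)
    show "g x = 0" if "x \<notin> cball 0 R" for x using that unfolding g_def by simp
    have "(\<lambda>n. LINT x|lborel. (f (k n) x)\<^sup>2) \<longlonglongrightarrow> (LINT x|lborel. (g x)\<^sup>2)" by (rule conv(2))
    then show "(LINT x|lborel. (g x)\<^sup>2) = s"
      unfolding lip_classD(4)[OF f] by (simp add: LIMSEQ_const_iff)
    have "emeasure lborel {x. 0 < g x} = (\<integral>\<^sup>+x. indicator {x. 0 < g x} x \<partial>lborel)" by simp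
    also have "\<dots> \<le> (\<integral>\<^sup>+x. liminf (\<lambda>n. indicator {x. 0 < f (k n) x} x) \<partial>lborel)"
    proof (rule nn_integral_mono)
      fix x
      show "indicator {x. 0 < g x} x \<le> liminf (\<lambda>n. indicator {x. 0 < f (k n) x} x :: ennreal)"
      proof (cases "0 < g x")
        case True
        have "eventually (\<lambda>n. 0 < f (k n) x) sequentially" by (rule order_tendstoD(1)[OF lim True])
        then show ?thesis
          by (intro Liminf_bounded) (auto elim!: eventually_mono simp: indicator_def)
      qed simp
    qed
    also have "\<dots> \<le> liminf (\<lambda>n. \<integral>\<^sup>+x. indicator {x. 0 < f (k n) x} x \<partial>lborel)"
      by (rule nn_integral_liminf) measurable
    also have "\<dots> \<le> liminf (\<lambda>n::nat. ennreal V)"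
      using lip_classD(5)[OF f] by (intro Liminf_mono always_eventually) auto
    also have "\<dots> = ennreal V" by (simp add: Liminf_const)
    finally show "emeasure lborel {x. 0 < g x} \<le> ennreal V" .
  qed
  have "M \<le> energy g g"
  proof (rule LIMSEQ_le[OF _ conv(1)])
    have "(\<lambda>n. M - 1 / real (Suc n)) \<longlonglongrightarrow> M"
      using LIMSEQ_inverse_real_of_nat_add_minus[of M] by (simp add: inverse_eq_divide)
    then show "(\<lambda>n. M - 1 / real (Suc (k n))) \<longlonglongrightarrow> M"
      using LIMSEQ_subseq_LIMSEQ[OF _ k] by (auto simp: o_def)
    show "\<exists>N. \<forall>n\<ge>N. M - 1 / real (Suc (k n)) \<le> energy (f (k n)) (f (k n))"
      using fM by (auto intro: less_imp_le)
  qed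
  moreover have "energy f' f' \<le> M" if "f' \<in> ?C" for f'
    unfolding M_def A_def by (rule cSUP_upper[OF that bdd[unfolded A_def]])
  ultimately show ?thesis using gC by (intro bexI[of _ g]) (auto intro: order_trans)
qed

text \<open>One of the two sides of a line contains the origin, and polarization towards that side stays in the
class.\<close>

lemma energy_maximizer_one_sided:
  assumes L: "0 \<le> L" and R: "0 \<le> R" and g: "g \<in> lip_class L R V s"
    and max: "\<And>f. f \<in> lip_class L R V s \<Longrightarrow> energy f f \<le> energy g g"
  shows "one_sided g"
proof -
  have *: "(AE x in lborel. 0 \<le> side n t x * (g x - g (mirror n t x))) \<or>
    (AE x in lborel. side n t x * (g x - g (mirror n t x)) \<le> 0)"
    if n: "norm n = 1" and t: "t \<le> 0" for n t
  proof (rule energy_polarize_equality[OF n R lip_class_L2on[OF g L R]])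
    show "energy (polarize n t g) (polarize n t g) = energy g g"
      using max[OF polarize_lip_class[OF n t L g]] energy_le_energy_polarize[OF n R lip_class_L2on[OF g L R], of t]
      by linarith
  qed
  show ?thesis
    unfolding one_sided_def
  proof (intro allI impI)
    fix n :: "real^2" and t :: real assume n: "norm n = 1"
    show "(AE x in lborel. 0 \<le> side n t x * (g x - g (mirror n t x))) \<or>
      (AE x in lborel. side n t x * (g x - g (mirror n t x)) \<le> 0)"
    proof (cases "t \<le> 0")
      case True
      then show ?thesis by (rule *[OF n])
    next
      case False
      then show ?thesis using *[of "- n" "- t"] n by (auto simp: mirror_neg side_neg)
    qed
  qed
qed

text \<open>By maximality it suffices to bound the energy of a maximizer. Its support is a disc up to a null set,
and of radius at most \<open>\<rho>\<close>, so a translate of it is a test function for the disc.\<close>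

lemma energy_le_lipschitz:
  assumes \<rho>: "0 < \<rho>" and m: "\<And>v. v \<in> L2on (ball 0 \<rho>) \<Longrightarrow> energy v v \<le> m * (LINT x|lborel. (v x)\<^sup>2)"
    and L: "0 \<le> L" and R: "0 \<le> R" and f: "f \<in> lip_class L R (pi * \<rho>\<^sup>2) s"
  shows "energy f f \<le> m * s"
proof -
  obtain g where g: "g \<in> lip_class L R (pi * \<rho>\<^sup>2) s"
    and max: "\<And>f. f \<in> lip_class L R (pi * \<rho>\<^sup>2) s \<Longrightarrow> energy f f \<le> energy g g"
    using exists_energy_maximizer[OF L R] f by blast
  define U where "U = {x. 0 < g x}"
  have cont: "continuous_on UNIV g" by (rule lip_class_continuous[OF g L])
  have gm [measurable]: "g \<in> borel_measurable borel" by (rule borel_measurable_continuous_onI[OF cont])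
  have U_open: "open U" unfolding U_def
    using open_Collect_less[OF continuous_on_const cont] by simp
  have U_sub: "U \<subseteq> cball 0 R" using lip_classD(3)[OF g] unfolding U_def by force
  have g_off: "g x = 0" if "x \<notin> U" for x
    using that lip_classD(2)[OF g, of x] unfolding U_def by simp
  have "energy g g \<le> m * s"
  proof (cases "U = {}")
    case True
    then have "g = (\<lambda>x. 0)" using g_off by auto
    then show ?thesis using lip_classD(4)[OF g] by (simp add: energy_def)
  next
    case False
    have "one_sided (indicator U)" unfolding U_def
      by (rule one_sided_support[OF energy_maximizer_one_sided[OF L R g max] lip_classD(2)[OF g]])
    then obtain a r where r: "0 < r" and U_ball: "U \<subseteq> ball a r"
      and U_meas: "emeasure lborel U = ennreal (pi * r\<^sup>2)"
      using one_sided_open_is_ball[OF U_open bounded_subset[OF bounded_cball U_sub] False] by blast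
    have "ennreal (pi * r\<^sup>2) \<le> ennreal (pi * \<rho>\<^sup>2)"
      using lip_classD(5)[OF g] unfolding U_meas[symmetric] U_def .
    then have "r\<^sup>2 \<le> \<rho>\<^sup>2" by (simp add: ennreal_le_iff)
    then have r_le: "r \<le> \<rho>" by (rule power2_le_imp_le) (use \<rho> in simp)
    define v where "v x = g (a + x)" for x
    have vm [measurable]: "v \<in> borel_measurable borel" unfolding v_def by measurable
    have v_int: "(LINT x|lborel. (v x)\<^sup>2) = (LINT x|lborel. (g x)\<^sup>2)"
      unfolding v_def using integral_distr[of "(+) a" lborel borel "\<lambda>x. (g x)\<^sup>2"]
      by (simp add: lborel_distr_plus)
    have "v \<in> L2on (ball 0 \<rho>)"
    proof (rule bounded_L2on[where R = \<rho> and B = "L * (2 * R + 1)"])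
      show "\<bar>v x\<bar> \<le> L * (2 * R + 1)" for x unfolding v_def by (rule lip_class_bounded[OF g L R])
      show "v x = 0" if "x \<notin> ball 0 \<rho>" for x
      proof -
        have "a + x \<notin> ball a r" using that r_le by (simp add: dist_norm)
        then show ?thesis unfolding v_def using U_ball by (intro g_off) blast
      qed
    qed auto
    then have "energy v v \<le> m * (LINT x|lborel. (v x)\<^sup>2)" by (rule m)
    moreover have "energy v v = energy g g"
      unfolding v_def using lborel_distr_plus[of a]
      by (intro energy_isometry) auto
    ultimately show ?thesis using v_int lip_classD(4)[OF g] by simp
  qed
  then show ?thesis using max[OF f] by linarith
qed

section \<open>Lower semicontinuous functions\<close>

text \<open>The largest \<open>k\<close>-Lipschitz function below \<open>v\<close>.\<close>

definition inf_conv :: "(real^2 \<Rightarrow> real) \<Rightarrow> real \<Rightarrow> real^2 \<Rightarrow> real" where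
  "inf_conv v k x = (INF y. v y + k * dist x y)"

context
  fixes v :: "real^2 \<Rightarrow> real" and k :: real
  assumes nonneg: "\<And>x. 0 \<le> v x" and k: "0 \<le> k"
begin

lemma bdd_below_inf_conv: "bdd_below (range (\<lambda>y. v y + k * dist x y))"
  by (rule bdd_belowI2[of _ 0]) (use nonneg k in simp)

lemma inf_conv_le: "inf_conv v k x \<le> v y + k * dist x y"
  unfolding inf_conv_def by (rule cINF_lower[OF bdd_below_inf_conv]) simp

lemma inf_conv_le_self: "inf_conv v k x \<le> v x"
  using inf_conv_le[of x x] by simp

lemma inf_conv_nonneg: "0 \<le> inf_conv v k x"
  unfolding inf_conv_def by (rule cINF_greatest) (use nonneg k in auto)

lemma inf_conv_lipschitz: "\<bar>inf_conv v k x - inf_conv v k y\<bar> \<le> k * dist x y"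
proof -
  have *: "inf_conv v k x - k * dist x y \<le> inf_conv v k y" for x y
    unfolding inf_conv_def[of v k y]
  proof (rule cINF_greatest)
    fix z
    have "k * dist x z \<le> k * (dist x y + dist y z)"
      using k by (intro mult_left_mono dist_triangle) auto
    then show "inf_conv v k x - k * dist x y \<le> v z + k * dist y z"
      using inf_conv_le[of x z] by (simp add: distrib_left)
  qed simp
  show ?thesis using *[of x y] *[of y x] by (simp add: dist_commute abs_le_iff)
qed

end

lemma inf_conv_tendsto:
  fixes v :: "real^2 \<Rightarrow> real"
  assumes nonneg: "\<And>x. 0 \<le> v x" and lsc: "\<And>c. open {x. c < v x}"
  shows "(\<lambda>n. inf_conv v (real n) x) \<longlonglongrightarrow> v x"
proof (rule LIMSEQ_I)
  fix e :: real assume e: "0 < e"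
  have "open {y. v x - e / 2 < v y}" "x \<in> {y. v x - e / 2 < v y}" using lsc e by auto
  then obtain d where d: "0 < d" "ball x d \<subseteq> {y. v x - e / 2 < v y}"
    using open_contains_ball by blast
  obtain N where N: "v x / d \<le> real N" using real_arch_simple by blast
  have "norm (inf_conv v (real n) x - v x) < e" if n: "N \<le> n" for n
  proof -
    have "v x / d \<le> real n" using N n by linarith
    then have nd: "v x \<le> real n * d" using d(1) by (simp add: field_simps)
    have "v x - e / 2 \<le> inf_conv v (real n) x"
      unfolding inf_conv_def
    proof (rule cINF_greatest)
      fix y
      show "v x - e / 2 \<le> v y + real n * dist x y"
      proof (cases "dist x y < d")
        case True
        then have "v x - e / 2 < v y" using d(2) by auto
        then show ?thesis by (simp add: add_increasing2)
      next
        case False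
        then have "real n * d \<le> real n * dist x y" by (intro mult_left_mono) auto
        then show ?thesis using nd nonneg[of y] e by linarith
      qed
    qed simp
    moreover have "inf_conv v (real n) x \<le> v x"
      by (rule inf_conv_le_self[OF nonneg]) simp
    ultimately show ?thesis using e by simp
  qed
  then show "\<exists>no. \<forall>n\<ge>no. norm (inf_conv v (real n) x - v x) < e" by blast
qed

lemma lsc_measurable:
  fixes v :: "real^2 \<Rightarrow> real"
  assumes "\<And>c. open {x. c < v x}"
  shows "v \<in> borel_measurable borel"
  using assms by (intro borel_measurable_iff_greater[THEN iffD2]) (auto simp: space_borel)

text \<open>The functions \<open>inf_conv v n\<close> are Lipschitz, lie between \<open>0\<close> and \<open>v\<close>, and converge to \<open>v\<close>. Being below
\<open>v\<close>, they have no larger support, so the bound on its area is inherited.\<close>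

lemma energy_le_lsc:
  assumes \<rho>: "0 < \<rho>" and m: "\<And>v. v \<in> L2on (ball 0 \<rho>) \<Longrightarrow> energy v v \<le> m * (LINT x|lborel. (v x)\<^sup>2)"
    and R: "0 \<le> R" and nonneg: "\<And>x. 0 \<le> v x" and bd: "\<And>x. v x \<le> B"
    and lsc: "\<And>c. open {x. c < v x}" and off: "\<And>x. x \<notin> cball 0 R \<Longrightarrow> v x = 0"
    and meas: "emeasure lborel {x. 0 < v x} \<le> ennreal (pi * \<rho>\<^sup>2)"
  shows "energy v v \<le> m * (LINT x|lborel. (v x)\<^sup>2)"
proof -
  define f where "f n = inf_conv v (real n)" for n
  have f_le: "f n x \<le> v x" and f_nonneg: "0 \<le> f n x" for n x
    unfolding f_def by (auto intro: inf_conv_le_self inf_conv_nonneg nonneg)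
  have f_off: "f n x = 0" if "x \<notin> cball 0 R" for n x
    using f_le[of n x] f_nonneg[of n x] off[OF that] by simp
  have f_bd: "\<bar>f n x\<bar> \<le> B" for n x
    using f_le[of n x] f_nonneg[of n x] bd[of x] by simp
  have vb: "{x. 0 < v x} \<in> sets lborel" using lsc[of 0] by simp
  have fC: "f n \<in> lip_class (real n) R (pi * \<rho>\<^sup>2) (LINT x|lborel. (f n x)\<^sup>2)" for n
    unfolding lip_class_def
  proof (intro CollectI conjI allI impI)
    show "\<bar>f n x - f n y\<bar> \<le> real n * dist x y" for x y
      unfolding f_def by (rule inf_conv_lipschitz[OF nonneg]) simp
    have "{x. 0 < f n x} \<subseteq> {x. 0 < v x}" using f_le[of n] by (auto intro: less_le_trans)
    then have "emeasure lborel {x. 0 < f n x} \<le> emeasure lborel {x. 0 < v x}"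
      using vb by (rule emeasure_mono)
    then show "emeasure lborel {x. 0 < f n x} \<le> ennreal (pi * \<rho>\<^sup>2)" using meas by (rule order_trans)
  qed (auto simp: f_nonneg intro: f_off)
  have fm: "f n \<in> borel_measurable borel" for n
    by (rule borel_measurable_continuous_onI[OF lip_class_continuous[OF fC]]) simp
  have lim: "(\<lambda>n. f n x) \<longlonglongrightarrow> v x" for x
    unfolding f_def by (rule inf_conv_tendsto[OF nonneg lsc])
  note conv = energy_bounded_convergence[OF R fm f_bd f_off lim]
  have "energy (f n) (f n) \<le> m * (LINT x|lborel. (f n x)\<^sup>2)" for n
    by (rule energy_le_lipschitz[OF \<rho> m _ R fC]) simp_all
  then show ?thesis
    by (intro LIMSEQ_le[OF conv(1) tendsto_mult_left[OF conv(2)]]) auto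
qed

text \<open>On the line itself, \<open>v\<close> and its mirror image agree, so both are large near a point of the line at which
\<open>v\<close> is large.\<close>

lemma polarize_lsc:
  assumes lsc: "\<And>c. open {x. c < v x}"
  shows "open {x. c < polarize n t v x}"
proof -
  let ?A = "{x. c < v x}"
  let ?A' = "mirror n t -` ?A"
  have A': "open ?A'"
    by (rule open_vimage[OF lsc]) (intro continuous_on_mirror continuous_on_id)
  have H: "open {x. t < x \<bullet> n}"
    by (intro open_Collect_less continuous_intros)
  have "{x. c < polarize n t v x} = (?A \<inter> ?A') \<union> ({x. t < x \<bullet> n} \<inter> (?A \<union> ?A'))"
  proof (intro set_eqI)
    fix x
    consider "t < x \<bullet> n" | "x \<bullet> n = t" | "x \<bullet> n < t" by linarith
    then show "x \<in> {x. c < polarize n t v x} \<longleftrightarrow> x \<in> (?A \<inter> ?A') \<union> ({x. t < x \<bullet> n} \<inter> (?A \<union> ?A'))"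
      by cases (auto simp: polarize_def mirror_on_line max_def min_def)
  qed
  also have "open \<dots>" using lsc A' H by (intro open_Un open_Int) auto
  finally show ?thesis .
qed

text \<open>A polarization of \<open>v\<close> obeys the same bound as \<open>v\<close>, with the same right-hand side. So polarizing an
extremal \<open>v\<close> cannot increase its energy.\<close>

lemma energy_eq_imp_one_sided:
  assumes \<rho>: "0 < \<rho>" and m: "\<And>v. v \<in> L2on (ball 0 \<rho>) \<Longrightarrow> energy v v \<le> m * (LINT x|lborel. (v x)\<^sup>2)"
    and R: "0 \<le> R" and nonneg: "\<And>x. 0 \<le> v x" and bd: "\<And>x. v x \<le> B"
    and lsc: "\<And>c. open {x. c < v x}" and off: "\<And>x. x \<notin> cball 0 R \<Longrightarrow> v x = 0"
    and meas: "emeasure lborel {x. 0 < v x} \<le> ennreal (pi * \<rho>\<^sup>2)"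
    and eq: "energy v v = m * (LINT x|lborel. (v x)\<^sup>2)"
  shows "one_sided v"
  unfolding one_sided_def
proof (intro allI impI)
  fix n :: "real^2" and t :: real assume n: "norm n = 1"
  note vm = lsc_measurable[OF lsc]
  have "\<bar>v x\<bar> \<le> B" for x using nonneg[of x] bd[of x] by simp
  then have vL: "v \<in> L2on (cball 0 R)"
    using off by (intro bounded_L2on[OF vm]) auto
  have pol_off: "polarize n t v x = 0" if x: "x \<notin> cball 0 (R + 2 * \<bar>t\<bar>)" for x
  proof -
    have "v x = 0" using x by (intro off) auto
    moreover have "v (mirror n t x) = 0"
      using x norm_le_norm_mirror[OF n, of x t] by (intro off) auto
    ultimately show ?thesis by (simp add: polarize_def)
  qed
  have "energy (polarize n t v) (polarize n t v) \<le> m * (LINT x|lborel. (polarize n t v x)\<^sup>2)"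
  proof (rule energy_le_lsc[OF \<rho> m, where R = "R + 2 * \<bar>t\<bar>"])
    show "0 \<le> polarize n t v x" for x using nonneg[of x] nonneg[of "mirror n t x"] by (auto simp: polarize_def)
    show "polarize n t v x \<le> B" for x using bd[of x] bd[of "mirror n t x"] by (auto simp: polarize_def)
    show "open {x. c < polarize n t v x}" for c by (rule polarize_lsc[OF lsc])
    show "emeasure lborel {x. 0 < polarize n t v x} \<le> ennreal (pi * \<rho>\<^sup>2)"
      unfolding emeasure_pos_polarize[OF n vm] by (rule meas)
    show "polarize n t v x = 0" if "x \<notin> cball 0 (R + 2 * \<bar>t\<bar>)" for x using that by (rule pol_off)
  qed (use R in auto)
  also have "\<dots> = energy v v"
    unfolding integral_square_polarize[OF n vm] eq ..
  finally have "energy (polarize n t v) (polarize n t v) = energy v v"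
    using energy_le_energy_polarize[OF n R vL, of t] by (rule antisym)
  then show "(AE x in lborel. 0 \<le> side n t x * (v x - v (mirror n t x))) \<or>
      (AE x in lborel. side n t x * (v x - v (mirror n t x)) \<le> 0)"
    by (rule energy_polarize_equality[OF n R vL])
qed

section \<open>The eigenvalue comparison\<close>

lemma star_ball_eq:
  assumes O: "open \<Omega>" "bounded \<Omega>" "\<Omega> \<noteq> {}"
  obtains \<rho> where "0 < \<rho>" "star_ball \<Omega> = ball 0 \<rho>" "emeasure lborel \<Omega> = ennreal (pi * \<rho>\<^sup>2)"
proof -
  have fin: "emeasure lborel \<Omega> < \<infinity>" by (rule emeasure_bounded_finite[OF O(2)])
  have Ob: "\<Omega> \<in> sets lborel" using O(1) by simp
  define A where "A = measure lborel \<Omega>"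
  have A: "emeasure lborel \<Omega> = ennreal A"
    unfolding A_def using fin by (intro emeasure_eq_ennreal_measure) auto
  have "0 < A" unfolding A_def by (rule measure_open_bounded_pos[OF O])
  define \<rho> where "\<rho> = sqrt (A / pi)"
  have \<rho>: "0 < \<rho>" "pi * \<rho>\<^sup>2 = A" using \<open>0 < A\<close> by (auto simp: \<rho>_def)
  have ball: "emeasure lebesgue (ball (0::real^2) r) = ennreal (pi * r\<^sup>2)" if "0 \<le> r" for r
    using emeasure_lborel_ball_plane[OF that, of 0] by (simp add: emeasure_completion)
  have "(THE r. 0 \<le> r \<and> emeasure lebesgue (ball (0::real^2) r) = emeasure lebesgue \<Omega>) = \<rho>"
  proof (rule the_equality)
    have O_eq: "emeasure lebesgue \<Omega> = ennreal (pi * \<rho>\<^sup>2)"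
      using A Ob \<rho>(2) by (simp add: emeasure_completion)
    then show "0 \<le> \<rho> \<and> emeasure lebesgue (ball (0::real^2) \<rho>) = emeasure lebesgue \<Omega>"
      using ball[of \<rho>] \<rho>(1) by simp
    fix r assume r: "0 \<le> r \<and> emeasure lebesgue (ball (0::real^2) r) = emeasure lebesgue \<Omega>"
    then have "ennreal (pi * r\<^sup>2) = ennreal (pi * \<rho>\<^sup>2)" using ball[of r] O_eq by simp
    then have "r\<^sup>2 = \<rho>\<^sup>2" by (subst (asm) ennreal_inj) auto
    then show "r = \<rho>" using r \<rho>(1) by (simp add: power2_eq_iff_nonneg)
  qed
  then have "star_ball \<Omega> = ball 0 \<rho>" by (simp add: star_ball_def)
  with \<rho> A show ?thesis by (intro that[of \<rho>]) auto
qed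

lemma energy_cong_AE:
  assumes R: "0 \<le> R" and u: "u \<in> L2on (cball 0 R)" and v: "v \<in> L2on (cball 0 R)"
    and uv: "AE x in lborel. u x = v x"
  shows "energy u u = energy v v"
proof -
  note [measurable] = L2onD(1)[OF u] L2onD(1)[OF v]
  have T: "logT u x = logT v x" for x
    unfolding logT_def by (rule integral_cong_AE) (use uv in \<open>auto elim: eventually_mono\<close>)
  show ?thesis
    unfolding energy_iterated[OF R u u] energy_iterated[OF R v v] T
    by (rule integral_cong_AE) (use uv in \<open>auto elim: eventually_mono\<close>)
qed

lemma continuous_on_logT:
  assumes R: "0 \<le> R" and u: "u \<in> L2on (cball 0 R)"
  shows "continuous_on (cball 0 R) (logT u)"
  unfolding continuous_on_iff
proof (intro ballI allI impI)
  fix x :: "real^2" and e :: real assume x: "x \<in> cball 0 R" and e: "0 < e"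
  define C where "C = Hoelder_const R * (LINT y|lborel. (u y)\<^sup>2) + 1"
  have "0 \<le> (LINT y|lborel. (u y)\<^sup>2)" by (intro integral_nonneg_AE) auto
  then have C: "0 < C" "Hoelder_const R * (LINT y|lborel. (u y)\<^sup>2) \<le> C"
    unfolding C_def using Hoelder_const_pos[of R] by (auto simp: add_nonneg_pos)
  have "dist (logT u x') (logT u x) < e" if x': "x' \<in> cball 0 R" "dist x' x < e\<^sup>2 / C" for x'
  proof -
    have "(logT u x' - logT u x)\<^sup>2 \<le> Hoelder_const R * (LINT y|lborel. (u y)\<^sup>2) * norm (x' - x)"
      by (rule logT_Hoelder[OF R x'(1) x u])
    also have "\<dots> \<le> C * norm (x' - x)" using C(2) by (rule mult_right_mono) simp
    also have "\<dots> < e\<^sup>2" using x'(2) C(1) by (simp add: dist_norm field_simps)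
    finally have "\<bar>logT u x' - logT u x\<bar>\<^sup>2 < e\<^sup>2" by simp
    then have "\<bar>logT u x' - logT u x\<bar> < e" by (rule power2_less_imp_less) (use e in simp)
    then show ?thesis by (simp add: dist_real_def)
  qed
  then show "\<exists>d>0. \<forall>x'\<in>cball 0 R. dist x' x < d \<longrightarrow> dist (logT u x') (logT u x) < e"
    using e C(1) by (intro exI[of _ "e\<^sup>2 / C"]) auto
qed

text \<open>Off \<open>\<Omega>\<close> the representative is \<open>0\<close>, and on \<open>\<Omega>\<close> it is the potential of the eigenfunction divided by
the eigenvalue. The latter is continuous, and nonnegative everywhere on \<open>\<Omega>\<close> because it is positive
almost everywhere there. Together this is a lower semicontinuous function.\<close>

lemma lsc_representative:
  assumes O: "open \<Omega>" "\<Omega> \<subseteq> cball 0 R" "0 \<le> R" and \<tau>: "0 < \<tau>"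
    and e: "positive_log_eigenfunction \<Omega> \<tau> u"
  shows "\<exists>v B. (\<forall>x. 0 \<le> v x) \<and> (\<forall>x. v x \<le> B) \<and> (\<forall>c. open {x. c < v x}) \<and> (\<forall>x. x \<notin> \<Omega> \<longrightarrow> v x = 0) \<and>
    \<Omega> - {x. 0 < v x} \<in> null_sets lborel \<and> 0 < (LINT x|lborel. (v x)\<^sup>2) \<and>
    energy v v = 2 * pi * \<tau> * (LINT x|lborel. (v x)\<^sup>2)"
proof -
  have ef: "log_eigenfunction \<Omega> \<tau> u" and pos: "\<And>x. x \<in> \<Omega> \<Longrightarrow> 0 < u x"
    using e by (auto simp: positive_log_eigenfunction_def)
  obtain w where w: "w \<in> L2on \<Omega>" and uw: "AE x in lborel. x \<in> \<Omega> \<longrightarrow> u x = w x"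
    and Tw: "AE x in lborel. x \<in> \<Omega> \<longrightarrow> logT w x = 2 * pi * \<tau> * w x"
    and N: "0 < (LINT x|lborel. (w x)\<^sup>2)"
    and Ew: "energy w w = 2 * pi * \<tau> * (LINT x|lborel. (w x)\<^sup>2)"
    by (rule log_eigenfunction_L2on[OF O ef])
  note wR = L2on_mono[OF O(2) w]
  have Ob [measurable]: "\<Omega> \<in> sets borel" using O(1) by simp
  have contT: "continuous_on \<Omega> (logT w)"
    using continuous_on_logT[OF O(3) wR] O(2) by (rule continuous_on_subset)
  note wm [measurable] = L2onD(1)[OF w]
  define c0 where "c0 = 2 * pi * \<tau>"
  have c0: "0 < c0" using \<tau> by (simp add: c0_def)
  have T_pos_AE: "AE x in lborel. x \<in> \<Omega> \<longrightarrow> 0 < logT w x"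
    using uw Tw
  proof eventually_elim
    case (elim x)
    then show ?case using pos[of x] c0 by (auto simp: c0_def)
  qed
  have T_nonneg: "0 \<le> logT w x" if x: "x \<in> \<Omega>" for x
  proof (rule ccontr)
    assume "\<not> 0 \<le> logT w x"
    define S where "S = \<Omega> \<inter> logT w -` {..<0}"
    have "open S" unfolding S_def
      by (rule continuous_open_preimage[OF contT O(1)]) simp
    moreover have "x \<in> S" using x \<open>\<not> 0 \<le> logT w x\<close> by (simp add: S_def)
    ultimately have "\<not> negligible S" using open_not_negligible by blast
    moreover have "AE y in lborel. y \<notin> S"
      using T_pos_AE by eventually_elim (auto simp: S_def)
    then have "S \<in> null_sets lborel" using \<open>open S\<close> by (subst AE_iff_null_sets) auto
    then have "negligible S" unfolding negligible_iff_null_sets by (rule null_sets_completionI)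
    ultimately show False by simp
  qed
  define v where "v x = (if x \<in> \<Omega> then logT w x / c0 else 0)" for x
  have v_nonneg: "0 \<le> v x" for x using T_nonneg c0 by (simp add: v_def)
  define B where "B = sqrt (slice_bound R * (LINT x|lborel. (w x)\<^sup>2)) / c0"
  have B0: "0 \<le> B" unfolding B_def using c0 N slice_bound_nonneg by simp
  have v_bd: "v x \<le> B" for x
  proof (cases "x \<in> \<Omega>")
    case True
    then have "(logT w x)\<^sup>2 \<le> slice_bound R * (LINT x|lborel. (w x)\<^sup>2)"
      using O(2) by (intro logT_square_le[OF O(3) _ wR]) blast
    then have "logT w x \<le> sqrt (slice_bound R * (LINT x|lborel. (w x)\<^sup>2))" by (rule real_le_rsqrt)
    then show ?thesis using True c0 by (simp add: v_def B_def divide_right_mono)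
  next
    case False
    then show ?thesis using B0 by (simp add: v_def)
  qed
  have v_lsc: "open {x. c < v x}" for c
  proof (cases "c < 0")
    case True
    then have "{x. c < v x} = UNIV" using v_nonneg by (auto intro: less_le_trans)
    then show ?thesis by simp
  next
    case False
    then have "{x. c < v x} = \<Omega> \<inter> logT w -` {c * c0<..}"
      using c0 by (auto simp: v_def field_simps)
    also have "open \<dots>" by (rule continuous_open_preimage[OF contT O(1)]) simp
    finally show ?thesis .
  qed
  have v_off: "v x = 0" if "x \<notin> \<Omega>" for x using that by (simp add: v_def)
  have vm [measurable]: "v \<in> borel_measurable borel" by (rule lsc_measurable[OF v_lsc])
  have "\<bar>v x\<bar> \<le> B" for x using v_nonneg[of x] v_bd[of x] by simp
  then have vL: "v \<in> L2on \<Omega>" using v_off O(2) by (intro bounded_L2on[OF vm]) auto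
  have vw: "AE x in lborel. v x = w x"
    using Tw
  proof eventually_elim
    case (elim x)
    show ?case
      using elim c0 L2onD(3)[OF w, of x] by (cases "x \<in> \<Omega>") (auto simp: v_def c0_def)
  qed
  have sq: "(LINT x|lborel. (v x)\<^sup>2) = (LINT x|lborel. (w x)\<^sup>2)"
    by (rule integral_cong_AE) (use vw in \<open>auto elim: eventually_mono\<close>)
  have Ev: "energy v v = energy w w"
    by (rule energy_cong_AE[OF O(3) L2on_mono[OF O(2) vL] wR vw])
  have null: "\<Omega> - {x. 0 < v x} \<in> null_sets lborel"
  proof -
    have "AE x in lborel. x \<notin> \<Omega> - {x. 0 < v x}"
      using T_pos_AE by eventually_elim (use c0 in \<open>auto simp: v_def\<close>)
    then show ?thesis using O(1) v_lsc[of 0] by (subst AE_iff_null_sets) auto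
  qed
  show ?thesis
    using v_nonneg v_bd v_lsc v_off null N Ev Ew
    by (intro exI[of _ v] exI[of _ B] conjI allI impI) (simp_all only: sq)
qed

theorem theorem1p8:
  fixes \<Omega> :: "(real^2) set"
  assumes "open \<Omega>" and "bounded \<Omega>"
    and "\<exists>u. positive_log_eigenfunction \<Omega> (tau1 \<Omega>) u"
  shows "tau1 \<Omega> \<le> tau1 (star_ball \<Omega>) \<and>
    (tau1 \<Omega> = tau1 (star_ball \<Omega>) \<longrightarrow>
      (\<exists>a. almost_equal \<Omega> ((\<lambda>x. a + x) ` star_ball \<Omega>)))"
proof -
  let ?\<tau> = "tau1 \<Omega>" and ?\<tau>' = "tau1 (star_ball \<Omega>)"
  obtain u where u: "positive_log_eigenfunction \<Omega> ?\<tau> u" using assms(3) by blast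
  have ne: "\<Omega> \<noteq> {}"
    using u by (auto simp: positive_log_eigenfunction_def log_eigenfunction_def
        AE_lebesgue_on_open_iff[OF assms(1)])
  obtain R where R: "0 \<le> R" "\<Omega> \<subseteq> cball 0 R" by (rule bounded_subset_cball_0[OF assms(2)])
  obtain \<rho> where \<rho>: "0 < \<rho>" and star: "star_ball \<Omega> = ball 0 \<rho>"
    and meas: "emeasure lborel \<Omega> = ennreal (pi * \<rho>\<^sup>2)"
    by (rule star_ball_eq[OF assms(1,2) ne])
  have \<tau>'_pos: "0 < ?\<tau>'"
    unfolding star using \<rho> by (intro tau1_variational) auto
  have \<tau>'_le: "energy v v \<le> 2 * pi * ?\<tau>' * (LINT x|lborel. (v x)\<^sup>2)" if "v \<in> L2on (ball 0 \<rho>)" for v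
    using that \<rho> unfolding star by (intro tau1_variational(2)) auto
  show ?thesis
  proof (cases "0 < ?\<tau>")
    case False
    then show ?thesis using \<tau>'_pos by simp
  next
    case True
    obtain v B where v: "\<And>x. 0 \<le> v x" "\<And>x. v x \<le> B" "\<And>c. open {x. c < v x}"
      and off: "\<And>x. x \<notin> \<Omega> \<Longrightarrow> v x = 0" and null: "\<Omega> - {x. 0 < v x} \<in> null_sets lborel"
      and N: "0 < (LINT x|lborel. (v x)\<^sup>2)"
      and Ev: "energy v v = 2 * pi * ?\<tau> * (LINT x|lborel. (v x)\<^sup>2)"
      using lsc_representative[OF assms(1) R(2,1) True u] by blast
    define U where "U = {x. 0 < v x}"
    have U_open: "open U" unfolding U_def by (rule v(3))
    have U_sub: "U \<subseteq> \<Omega>" unfolding U_def using off by fastforce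
    have U_meas: "emeasure lborel U \<le> ennreal (pi * \<rho>\<^sup>2)"
      unfolding meas[symmetric] using U_sub assms(1) by (intro emeasure_mono) auto
    have offR: "v x = 0" if "x \<notin> cball 0 R" for x using off R(2) that by blast
    have "energy v v \<le> 2 * pi * ?\<tau>' * (LINT x|lborel. (v x)\<^sup>2)"
      by (rule energy_le_lsc[OF \<rho> \<tau>'_le R(1) v offR U_meas[unfolded U_def]])
    then have le: "?\<tau> \<le> ?\<tau>'"
      unfolding Ev using N by simp
    moreover have "\<exists>a. almost_equal \<Omega> ((\<lambda>x. a + x) ` star_ball \<Omega>)" if eq: "?\<tau> = ?\<tau>'"
    proof -
      have Ev': "energy v v = 2 * pi * ?\<tau>' * (LINT x|lborel. (v x)\<^sup>2)" using Ev eq by simp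
      have "one_sided v"
        by (rule energy_eq_imp_one_sided[OF \<rho> \<tau>'_le R(1) v offR U_meas[unfolded U_def] Ev'])
      then have "one_sided (indicator U)" unfolding U_def using v(1) by (rule one_sided_support)
      moreover have "U \<noteq> {}"
      proof
        assume "U = {}"
        then have "v x = 0" for x using v(1)[of x] unfolding U_def by (auto simp: not_less intro: antisym)
        then show False using N by simp
      qed
      ultimately obtain a r where r: "0 < r" and Ub: "U \<subseteq> ball a r" and nb: "ball a r - U \<in> null_sets lborel"
        and Um: "emeasure lborel U = ennreal (pi * r\<^sup>2)"
        using one_sided_open_is_ball[OF U_open bounded_subset[OF assms(2) U_sub]] by blast
      have "emeasure lborel \<Omega> = emeasure lborel U"
        using emeasure_Un_null_set[OF _ null[folded U_def], of U] U_open U_sub by (simp add: Un_absorb1)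
      then have "ennreal (pi * \<rho>\<^sup>2) = ennreal (pi * r\<^sup>2)" using meas Um by simp
      then have "\<rho>\<^sup>2 = r\<^sup>2" by (subst (asm) ennreal_inj) auto
      then have \<rho>r: "\<rho> = r" using \<rho> r by (simp add: power2_eq_iff_nonneg)
      have "sym_diff \<Omega> (ball a r) \<in> null_sets lebesgue"
      proof (rule null_sets_subset)
        show "(\<Omega> - U) \<union> (ball a r - U) \<in> null_sets lebesgue"
          using null[folded U_def] nb by (intro null_sets_completionI null_sets.Un)
        show "sym_diff \<Omega> (ball a r) \<in> sets lebesgue" using assms(1) by auto
        show "sym_diff \<Omega> (ball a r) \<subseteq> (\<Omega> - U) \<union> (ball a r - U)" using U_sub Ub by blast
      qed
      moreover have "(\<lambda>x. a + x) ` star_ball \<Omega> = ball a r"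
        unfolding star \<rho>r using ball_translation[of a 0 r] by simp
      ultimately show ?thesis unfolding almost_equal_def by (intro exI[of _ a]) simp
    qed
    ultimately show ?thesis by blast
  qed
qed

end
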